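(* Let $E$ be a real uniformly smooth and 2-uniformly convex Banach space with dual space $E^*$ and let $C$ be a nonempty closed convex subset of $E$. Let $A_1,\dots,A_M : C\to E^*$ be mappings and $\alpha>0$ a constant such that for each $i$: (V1) $A_i$ is $\alpha$-inverse strongly monotone; (V2) $VI(A_i,C)\neq\emptyset$; (V3) $\|A_iy\|\le\|A_iy-A_iu\|$ for all $y\in C$ and $u\in VI(A_i,C)$. Let $S_1,\dots,S_N: C\to C$ be closed and quasi $\phi$-nonexpansive mappings. Let $\{\alpha_n\}\subset[0,1]$ satisfy $\lim_{n\to\infty}\alpha_n=0$, and let $\lambda_n\in[a,b]$ for some $a,b\in(0,\alpha c^2/2)$, where $1/c$ is the 2-uniform convexity constant of $E$. Suppose that the interior of $$F=\Big(\bigcap_{i=1}^M VI(A_i,C)\Big)\cap\Big(\bigcap_{j=1}^N F(S_j)\Big)$$ is nonempty. Let $x_0\in C$ be arbitrary, and for $n\ge0$ define $$\begin{aligned} &y_n^i=\Pi_C\big(J^{-1}(Jx_n-\lambda_nA_ix_n)\big),\quad i=1,\dots,M,\\ &i_n\in\arg\max\{\|y_n^i-x_n\|:1\le i\le M\},\quad \bar y_n=y_n^{i_n},\\ &z_n^j=J^{-1}\big(\alpha_nJx_n+(1-\alpha_n)JS_j\bar y_n\big),\quad j=1,\dots,N,\\ &j_n\in\arg\max\{\|z_n^j-x_n\|:1\le j\le N\},\quad \bar z_n=z_n^{j_n},\\ &x_{n+1}=\Pi_C\bar z_n. \end{aligned}$$ Then $\{x_n\}$ converges strongly to some point $u\in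 F$. Moreover, $u=\lim_{n\to\infty}\Pi_Fx_n$.
   Context: $J:E\to E^*$ is the normalized duality mapping, $\langle Jx,x\rangle=\|x\|^2=\|Jx\|^2$ (single-valued and bijective here). The 2-uniform convexity constant $1/c$ of $E$: $c$ is the best (largest) constant in $(0,1]$ such that $\|x-y\|\le\frac{2}{c^2}\|Jx-Jy\|$ for all $x,y\in E$. Lyapunov functional: $\phi(x,y)=\|x\|^2-2\langle x,Jy\rangle+\|y\|^2$ for $x,y\in E$. For a nonempty closed convex $D\subset E$, the generalized projection $\Pi_D:E\to D$ is $\Pi_D(x)=\arg\min_{y\in D}\phi(y,x)$ (the unique minimizer). For $A:C\to E^*$: $A$ is $\alpha$-inverse strongly monotone if $\langle Ax-Ay,x-y\rangle\ge\alpha\|Ax-Ay\|^2$ for all $x,y\in C$; $VI(A,C)=\{p^*\in C:\langle Ap^*,p-p^*\rangle\ge0\ \forall p\in C\}$. For $T:C\to C$: $F(T)$ is the fixed point set. $T$ is closed if $x_n\in C$, $x_n\to x$ and $Tx_n\to y$ imply $Tx=y$. $T$ is quasi $\phi$-nonexpansive if $F(T)\ne\emptyset$ and $\phi(p,Tx)\le\phi(p,x)$ for all $p\in F(T)$, $x\in C$. Interior is taken in the norm topology of $E$. Ties in the $\arg\max$ are broken arbitrarily. *)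

theory Defs
  imports "HOL-Analysis.Analysis"
begin

text \<open>The dual space of \<open>'a\<close> is \<open>'a \<Rightarrow>\<^sub>L real\<close> with the operator norm.\<close>

text \<open>The modulus is taken in \<open>ereal\<close>, so that the infimum over the empty set
  (for \<open>\<epsilon> \<le> 2\<close>, only in the zero space) is \<open>\<infinity>\<close>. The side condition
  \<open>\<epsilon> \<le> norm (x - y)\<close> rather than equality gives the same value in
  dimension at least 2, and a meaningful one in dimension 1.\<close>

definition modulus_of_convexity :: "'a::real_normed_vector itself \<Rightarrow> real \<Rightarrow> ereal" where
  "modulus_of_convexity _ \<epsilon> =
     (INF (x, y) \<in> {(x, y :: 'a). norm x = 1 \<and> norm y = 1 \<and> \<epsilon> \<le> norm (x - y)}.
        ereal (1 - norm (x + y) / 2))"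

definition two_uniformly_convex :: "'a::real_normed_vector itself \<Rightarrow> bool" where
  "two_uniformly_convex E \<longleftrightarrow>
     (\<exists>k>0. \<forall>\<epsilon>\<in>{0<..2}. ereal (k * \<epsilon>\<^sup>2) \<le> modulus_of_convexity E \<epsilon>)"

definition uniformly_smooth :: "'a::real_normed_vector itself \<Rightarrow> bool" where
  "uniformly_smooth _ \<longleftrightarrow>
     (\<exists>l. uniform_limit (sphere (0 :: 'a) 1 \<times> sphere 0 1)
            (\<lambda>t (x, y). (norm (x + t *\<^sub>R y) - norm x) / t) l (at (0 :: real)))"

text \<open>The normalized duality mapping is set-valued in general; the description operator is
  meaningful on smooth spaces, where it is single-valued.\<close>

definition duality_map :: "'a::real_normed_vector \<Rightarrow> ('a \<Rightarrow>\<^sub>L real)" where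
  "duality_map x = (THE f. blinfun_apply f x = (norm x)\<^sup>2 \<and> (norm f)\<^sup>2 = (norm x)\<^sup>2)"

text \<open>This is \<open>c\<close> where \<open>1/c\<close> is the 2-uniform convexity constant.\<close>

definition two_convexity_c :: "'a::real_normed_vector itself \<Rightarrow> real" where
  "two_convexity_c _ =
     (GREATEST c. 0 < c \<and> c \<le> 1 \<and>
        (\<forall>x y :: 'a. norm (x - y) \<le> 2 / c\<^sup>2 * norm (duality_map x - duality_map y)))"

definition lyapunov :: "'a::real_normed_vector \<Rightarrow> 'a \<Rightarrow> real" where
  "lyapunov x y = (norm x)\<^sup>2 - 2 * blinfun_apply (duality_map y) x + (norm y)\<^sup>2"

definition gen_proj :: "'a::real_normed_vector set \<Rightarrow> 'a \<Rightarrow> 'a" where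
  "gen_proj D x = arg_min_on (\<lambda>y. lyapunov y x) D"

definition inverse_strongly_monotone_on ::
    "'a::real_normed_vector set \<Rightarrow> real \<Rightarrow> ('a \<Rightarrow> ('a \<Rightarrow>\<^sub>L real)) \<Rightarrow> bool" where
  "inverse_strongly_monotone_on C \<alpha> A \<longleftrightarrow>
     (\<forall>x\<in>C. \<forall>y\<in>C. \<alpha> * (norm (A x - A y))\<^sup>2 \<le> blinfun_apply (A x - A y) (x - y))"

definition VI :: "('a::real_normed_vector \<Rightarrow> ('a \<Rightarrow>\<^sub>L real)) \<Rightarrow> 'a set \<Rightarrow> 'a set" where
  "VI A C = {q \<in> C. \<forall>p\<in>C. 0 \<le> blinfun_apply (A q) (p - q)}"

definition fixed_points_on :: "'a set \<Rightarrow> ('a \<Rightarrow> 'a) \<Rightarrow> 'a set" where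
  "fixed_points_on C T = {x \<in> C. T x = x}"

definition closed_mapping_on :: "'a::real_normed_vector set \<Rightarrow> ('a \<Rightarrow> 'a) \<Rightarrow> bool" where
  "closed_mapping_on C T \<longleftrightarrow>
     (\<forall>\<xi> x y. (\<forall>n. \<xi> n \<in> C) \<and> \<xi> \<longlonglongrightarrow> x \<and> (\<lambda>n. T (\<xi> n)) \<longlonglongrightarrow> y \<longrightarrow> T x = y)"

definition quasi_phi_nonexpansive_on :: "'a::real_normed_vector set \<Rightarrow> ('a \<Rightarrow> 'a) \<Rightarrow> bool" where
  "quasi_phi_nonexpansive_on C T \<longleftrightarrow>
     fixed_points_on C T \<noteq> {} \<and>
     (\<forall>p\<in>fixed_points_on C T. \<forall>x\<in>C. lyapunov p (T x) \<le> lyapunov p x)"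

end

theory Submission
  imports Defs
begin

text \<open>Nonexpansiveness of the projections and of the \<open>S j\<close>, together with the inverse strong
  monotonicity of the \<open>A i\<close>, makes \<open>\<phi>(q, x n)\<close> decreasing in \<open>n\<close> for every \<open>q \<in> F\<close>. If \<open>F\<close>
  contains a ball with centre \<open>p\<close> and radius \<open>r\<close>, testing this at all points of the ball yields
  \<open>2 r \<parallel>J (x n) - J (x (n + 1))\<parallel> \<le> \<phi>(p, x n) - \<phi>(p, x (n + 1))\<close>, so \<open>J (x n)\<close>, and by
  2-uniform convexity \<open>x n\<close>, is a Cauchy sequence. Hypothesis (V3) says that the solutions of the
  variational inequality are the zeros of \<open>A i\<close>, and the quantities lost in the decrease of \<open>\<phi>\<close>
  control \<open>\<parallel>A i (x n)\<parallel>\<close> and \<open>\<parallel>z n j - x n\<parallel>\<close>, which puts the limit into \<open>F\<close>.\<close>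

section \<open>Convexity\<close>

text \<open>Unlike the modulus, this form of 2-uniform convexity concerns vectors of arbitrary norm.
  It survives the addition of a function affine in the vectors, which is how it reaches
  \<open>lyapunov\<close>.\<close>

definition midpoint_gap :: "'a::real_normed_vector itself \<Rightarrow> real \<Rightarrow> bool" where
  "midpoint_gap _ \<kappa> \<longleftrightarrow>
     (\<forall>x y :: 'a. (norm ((1/2) *\<^sub>R (x + y)))\<^sup>2 + \<kappa> * (norm (x - y))\<^sup>2 \<le> ((norm x)\<^sup>2 + (norm y)\<^sup>2) / 2)"

lemma two_uniformly_convex_unit:
  assumes "two_uniformly_convex TYPE('a::real_normed_vector)"
  obtains k where "k > 0"
    "\<And>x y :: 'a. norm x = 1 \<Longrightarrow> norm y = 1 \<Longrightarrow> norm (x + y) / 2 \<le> 1 - k * (norm (x - y))\<^sup>2"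
proof -
  obtain k where k: "k > 0"
    "\<And>\<epsilon>. \<epsilon> \<in> {0<..2} \<Longrightarrow> ereal (k * \<epsilon>\<^sup>2) \<le> modulus_of_convexity TYPE('a) \<epsilon>"
    using assms unfolding two_uniformly_convex_def by blast
  show thesis
  proof (rule that[OF k(1)])
    fix x y :: 'a assume xy: "norm x = 1" "norm y = 1"
    show "norm (x + y) / 2 \<le> 1 - k * (norm (x - y))\<^sup>2"
    proof (cases "x = y")
      case True
      then show ?thesis using xy norm_triangle_ineq[of y y] by simp
    next
      case False
      have "norm (x - y) \<le> 2" using norm_triangle_ineq4[of x y] xy by simp
      then have "ereal (k * (norm (x - y))\<^sup>2) \<le> modulus_of_convexity TYPE('a) (norm (x - y))"
        using False by (intro k) auto
      also have "\<dots> \<le> ereal (1 - norm (x + y) / 2)"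
        unfolding modulus_of_convexity_def
        by (rule INF_lower2[of "(x, y)"]) (use xy in auto)
      finally show ?thesis by simp
    qed
  qed
qed

text \<open>The unit estimate, applied to the directions of \<open>x\<close> and \<open>y\<close>,
  pays for the angle between them through the part \<open>s *\<^sub>R (u + v)\<close> of
  \<open>x + y\<close>. The difference of the norms is paid for by the identity \<open>((r + s) /
  2)\<^sup>2 + (r - s)\<^sup>2 / 4 = (r\<^sup>2 + s\<^sup>2) / 2\<close>.\<close>

lemma two_uniformly_convex_midpoint_gap:
  assumes "two_uniformly_convex TYPE('a::real_normed_vector)"
  obtains \<kappa> where "\<kappa> > 0" "midpoint_gap TYPE('a) \<kappa>"
proof -
  obtain k where k: "k > 0"
    "\<And>x y :: 'a. norm x = 1 \<Longrightarrow> norm y = 1 \<Longrightarrow> norm (x + y) / 2 \<le> 1 - k * (norm (x - y))\<^sup>2"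
    using two_uniformly_convex_unit[OF assms] by blast
  \<comment> \<open>Below, \<open>(norm (x - y))\<^sup>2\<close> is at most
    \<open>2 * (r - s)\<^sup>2 + 2 * (s * d)\<^sup>2\<close>. The bound \<open>1/8\<close> turns the
    first term into the available \<open>(r - s)\<^sup>2 / 4\<close>, and \<open>k/2\<close> turns
    the second into \<open>k * (s * d)\<^sup>2\<close>.\<close>
  define \<kappa> where "\<kappa> = min (1/8) (k/2)"
  have \<kappa>: "\<kappa> > 0" "\<kappa> \<le> 1/8" "\<kappa> \<le> k/2" using k(1) by (auto simp: \<kappa>_def)
  have gap: "(norm (x + y) / 2)\<^sup>2 + \<kappa> * (norm (x - y))\<^sup>2 \<le> ((norm x)\<^sup>2 + (norm y)\<^sup>2) / 2"
    if le: "norm y \<le> norm x" for x y :: 'a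
  proof (cases "y = 0")
    case True
    have "\<kappa> * (norm x)\<^sup>2 \<le> (1/8) * (norm x)\<^sup>2" by (intro mult_right_mono \<kappa>) auto
    also have "\<dots> \<le> (1/4) * (norm x)\<^sup>2" by simp
    finally show ?thesis using True by (simp add: power_divide)
  next
    case False
    define r s where "r = norm x" and "s = norm y"
    have rs: "s > 0" "r \<ge> s" using False le by (auto simp: r_def s_def)
    define u v where "u = x /\<^sub>R r" and "v = y /\<^sub>R s"
    have x: "x = r *\<^sub>R u" and y: "y = s *\<^sub>R v" using rs by (auto simp: u_def v_def)
    have uv: "norm u = 1" "norm v = 1"
      using rs by (simp_all add: u_def v_def flip: r_def s_def)
    define d where "d = norm (u - v)"
    have mid: "norm (u + v) / 2 \<le> 1 - k * d\<^sup>2" using k(2)[OF uv] by (simp add: d_def)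
    \<comment> \<open>This linearizes the square of \<open>k * d\<^sup>2\<close> that arises when
      the estimate for \<open>norm (x + y) / 2\<close> is squared.\<close>
    then have kd1: "k * d\<^sup>2 \<le> 1" using norm_ge_zero[of "u+v"] by linarith
    have kd0: "0 \<le> k * d\<^sup>2" using k(1) by simp
    have "x + y = s *\<^sub>R (u + v) + (r - s) *\<^sub>R u" by (simp add: x y algebra_simps)
    then have "norm (x + y) \<le> s * norm (u + v) + (r - s)"
      using norm_triangle_ineq[of "s *\<^sub>R (u + v)" "(r - s) *\<^sub>R u"] rs uv by simp
    also have "\<dots> \<le> s * (2 * (1 - k * d\<^sup>2)) + (r - s)"
      using mid rs by (intro add_right_mono mult_left_mono) auto
    finally have "norm (x + y) / 2 \<le> (r + s) / 2 - s * (k * d\<^sup>2)" by (simp add: algebra_simps)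
    then have "(norm (x + y) / 2)\<^sup>2 \<le> ((r + s) / 2 - s * (k * d\<^sup>2))\<^sup>2" by (intro power_mono) auto
    also have "\<dots> = ((r + s) / 2)\<^sup>2 - (r + s) * s * (k * d\<^sup>2) + s\<^sup>2 * ((k * d\<^sup>2) * (k * d\<^sup>2))"
      by (simp add: power2_eq_square field_simps)
    also have "\<dots> \<le> ((r + s) / 2)\<^sup>2 - (s + s) * s * (k * d\<^sup>2) + s\<^sup>2 * ((k * d\<^sup>2) * 1)"
      using rs kd0 kd1 by (intro add_mono diff_mono mult_mono mult_right_mono) auto
    also have "\<dots> = ((r + s) / 2)\<^sup>2 - k * (s * d)\<^sup>2" by (simp add: power2_eq_square algebra_simps)
    finally have 1: "(norm (x + y) / 2)\<^sup>2 \<le> ((r + s) / 2)\<^sup>2 - k * (s * d)\<^sup>2" .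
    have "x - y = (r - s) *\<^sub>R u + s *\<^sub>R (u - v)" by (simp add: x y algebra_simps)
    then have "norm (x - y) \<le> (r - s) + s * d"
      using norm_triangle_ineq[of "(r - s) *\<^sub>R u" "s *\<^sub>R (u - v)"] rs uv by (simp add: d_def)
    then have "(norm (x - y))\<^sup>2 \<le> ((r - s) + s * d)\<^sup>2" by (intro power_mono) auto
    also have "\<dots> \<le> 2 * (r - s)\<^sup>2 + 2 * (s * d)\<^sup>2"
      using sum_squares_bound[of "r - s" "s * d"] by (simp add: power2_sum)
    finally have "\<kappa> * (norm (x - y))\<^sup>2 \<le> \<kappa> * (2 * (r - s)\<^sup>2 + 2 * (s * d)\<^sup>2)"
      using \<kappa>(1) by (intro mult_left_mono) auto
    also have "\<dots> = \<kappa> * (2 * (r - s)\<^sup>2) + \<kappa> * (2 * (s * d)\<^sup>2)" by (simp add: algebra_simps)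
    also have "\<dots> \<le> (1/8) * (2 * (r - s)\<^sup>2) + (k/2) * (2 * (s * d)\<^sup>2)"
      by (intro add_mono mult_right_mono \<kappa>) auto
    finally have "(norm (x + y) / 2)\<^sup>2 + \<kappa> * (norm (x - y))\<^sup>2 \<le> ((r + s) / 2)\<^sup>2 + (r - s)\<^sup>2 / 4"
      using 1 by simp
    also have "\<dots> = (r\<^sup>2 + s\<^sup>2) / 2" by (simp add: power2_eq_square field_simps)
    finally show ?thesis by (simp add: r_def s_def)
  qed
  have "midpoint_gap TYPE('a) \<kappa>"
    unfolding midpoint_gap_def
  proof (intro allI)
    fix x y :: 'a
    show "(norm ((1/2) *\<^sub>R (x + y)))\<^sup>2 + \<kappa> * (norm (x - y))\<^sup>2 \<le> ((norm x)\<^sup>2 + (norm y)\<^sup>2) / 2"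
      using gap[of x y] gap[of y x] by (cases "norm x \<le> norm y") (auto simp: add.commute norm_minus_commute)
  qed
  then show thesis using \<kappa>(1) that by blast
qed

section \<open>The duality map\<close>

text \<open>A predicate form of the description in \<open>duality_map\<close>: existence and
  uniqueness must be settled before the description operator says anything.\<close>

definition is_dual :: "'a::real_normed_vector \<Rightarrow> ('a \<Rightarrow>\<^sub>L real) \<Rightarrow> bool" where
  "is_dual x f \<longleftrightarrow> blinfun_apply f x = (norm x)\<^sup>2 \<and> norm f = norm x"

lemma is_dual_scaleR:
  assumes "is_dual x f"
  shows "is_dual (r *\<^sub>R x) (r *\<^sub>R f)"
  using assms by (simp add: is_dual_def blinfun.scaleR_left blinfun.scaleR_right power_mult_distrib)
    (simp add: power2_eq_square)

text \<open>The derivative of the norm is odd, as the limit is two-sided, and sublinear, hence linear;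
  no Hahn-Banach theorem is needed.\<close>

lemma dual_of_norm_derivative:
  fixes x :: "'a::real_normed_vector"
  assumes x: "norm x = 1"
    and lim: "\<And>h. norm h = 1 \<Longrightarrow> \<exists>d. ((\<lambda>t. (norm (x + t *\<^sub>R h) - norm x) / t) \<longlongrightarrow> d) (at 0)"
  shows "\<exists>f. is_dual x f"
proof -
  define q where "q h t = (norm (x + t *\<^sub>R h) - norm x) / t" for h t
  have scale: "(q (r *\<^sub>R h) \<longlongrightarrow> r * d) (at 0)" if d: "(q h \<longlongrightarrow> d) (at 0)" for r h d
  proof (cases "r = 0")
    case True
    have "q 0 = (\<lambda>t. 0)" by (simp add: fun_eq_iff q_def)
    then show ?thesis using True by simp
  next
    case False
    \<comment> \<open>The limit is rescaled by the substitution \<open>r * t\<close>. A negative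
      \<open>r\<close> is allowed because the limit is two-sided; this is where oddness comes
      from.\<close>
    have "(\<lambda>t. r * t) \<midarrow>0\<rightarrow> r * 0" by (intro tendsto_intros)
    then have "filterlim (\<lambda>t. r * t) (at 0) (at (0::real))"
      using False by (simp add: filterlim_at eventually_at_filter)
    then have "((\<lambda>t. r * q h (r * t)) \<longlongrightarrow> r * d) (at 0)"
      by (intro tendsto_mult tendsto_const filterlim_compose[OF d])
    moreover have "r * q h (r * t) = q (r *\<^sub>R h) t" for t
      using False by (simp add: q_def mult.commute)
    ultimately show ?thesis by simp
  qed
  have ex: "\<exists>d. (q h \<longlongrightarrow> d) (at 0)" for h
  proof (cases "h = 0")
    case True
    then have "q h = (\<lambda>t. 0)" by (simp add: fun_eq_iff q_def)
    then show ?thesis by auto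
  next
    case False
    then obtain d where "(q (h /\<^sub>R norm h) \<longlongrightarrow> d) (at 0)"
      using lim[of "h /\<^sub>R norm h"] unfolding q_def by auto
    from scale[OF this, of "norm h"] show ?thesis using False by auto
  qed
  then obtain D where D: "\<And>h. (q h \<longlongrightarrow> D h) (at 0)" by metis
  have D_eq: "D h = d" if "(q h \<longlongrightarrow> d) (at 0)" for h d
    using D that by (intro tendsto_unique[of "at (0::real)"]) auto
  have D_scale: "D (r *\<^sub>R h) = r * D h" for r h
    by (rule D_eq[OF scale[OF D]])
  have D_sub: "D (h + h') \<le> D h + D h'" for h h'
  proof -
    have le: "q (h + h') t \<le> (q (2 *\<^sub>R h) t + q (2 *\<^sub>R h') t) / 2" if "t > 0" for t
    proof -
      \<comment> \<open>With doubled directions, \<open>x + t *\<^sub>R (h + h')\<close> is a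
        midpoint and the triangle inequality applies; homogeneity of \<open>D\<close> removes the
        factor 2 afterwards.\<close>
      have "2 *\<^sub>R (x + t *\<^sub>R (h + h')) = (x + t *\<^sub>R 2 *\<^sub>R h) + (x + t *\<^sub>R 2 *\<^sub>R h')"
        by (simp only: scaleR_add_right scaleR_2 add_ac)
      then have "2 * norm (x + t *\<^sub>R (h + h')) \<le> norm (x + t *\<^sub>R 2 *\<^sub>R h) + norm (x + t *\<^sub>R 2 *\<^sub>R h')"
        by (metis norm_scaleR abs_numeral norm_triangle_ineq)
      then have "(norm (x + t *\<^sub>R (h + h')) - norm x) / t
          \<le> ((norm (x + t *\<^sub>R 2 *\<^sub>R h) - norm x + (norm (x + t *\<^sub>R 2 *\<^sub>R h') - norm x)) / 2) / t"
        using that by (intro divide_right_mono) auto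
      then show ?thesis by (simp only: q_def add_divide_distrib divide_divide_eq_left mult.commute)
    qed
    have "D (h + h') \<le> (D (2 *\<^sub>R h) + D (2 *\<^sub>R h')) / 2"
    proof (rule tendsto_le)
      show "(q (h + h') \<longlongrightarrow> D (h + h')) (at_right 0)"
        by (rule filterlim_mono[OF D]) (auto simp: at_le)
      show "((\<lambda>t. (q (2 *\<^sub>R h) t + q (2 *\<^sub>R h') t) / 2) \<longlongrightarrow> (D (2 *\<^sub>R h) + D (2 *\<^sub>R h')) / 2) (at_right 0)"
        by (intro tendsto_divide tendsto_add tendsto_const filterlim_mono[OF D]) (auto simp: at_le)
      show "\<forall>\<^sub>F t in at_right 0. q (h + h') t \<le> (q (2 *\<^sub>R h) t + q (2 *\<^sub>R h') t) / 2"
        using le by (auto simp: eventually_at_right_less eventually_at_filter)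
    qed auto
    then show ?thesis by (simp add: D_scale)
  qed
  have D_add: "D (h + h') = D h + D h'" for h h'
  proof -
    \<comment> \<open>Superadditivity is subadditivity at the negated vectors.\<close>
    have "D ((- 1) *\<^sub>R h + (- 1) *\<^sub>R h') \<le> D ((- 1) *\<^sub>R h) + D ((- 1) *\<^sub>R h')" by (rule D_sub)
    then have "D ((- 1) *\<^sub>R (h + h')) \<le> D ((- 1) *\<^sub>R h) + D ((- 1) *\<^sub>R h')"
      by (simp add: scaleR_add_right)
    then show ?thesis using D_sub[of h h'] unfolding D_scale by linarith
  qed
  have q_le: "norm (q h t) \<le> norm h * 1" for h t
  proof (cases "t = 0")
    case False
    have "\<bar>norm (x + t *\<^sub>R h) - norm x\<bar> \<le> \<bar>t\<bar> * norm h"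
      using norm_triangle_ineq3[of "x + t *\<^sub>R h" x] by simp
    then show ?thesis using False by (simp add: q_def divide_le_eq mult.commute)
  qed (simp add: q_def)
  have D_le: "norm (D h) \<le> norm h * 1" for h
    by (rule tendsto_upperbound[OF tendsto_norm[OF D]]) (use q_le in auto)
  have lin: "bounded_linear D"
    by (rule bounded_linear_intro[of _ 1]) (use D_add D_scale D_le in auto)
  define f where "f = Blinfun D"
  have f: "blinfun_apply f h = D h" for h
    by (simp add: f_def bounded_linear_Blinfun_apply[OF lin])
  have "D x = 1"
  proof (rule D_eq)
    have "\<forall>\<^sub>F t in at 0. 1 = q x t"
    proof -
      have "1 = q x t" if "t \<noteq> 0" "dist t 0 < 1" for t :: real
      proof -
        have "x + t *\<^sub>R x = (1 + t) *\<^sub>R x" by (simp add: algebra_simps)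
        then show ?thesis using that x by (simp add: q_def)
      qed
      then show ?thesis unfolding eventually_at by (intro exI[of _ 1]) auto
    qed
    then show "(q x \<longlongrightarrow> 1) (at 0)"
      by (rule Lim_transform_eventually[rotated]) simp
  qed
  moreover have "norm f \<le> 1"
    by (rule norm_blinfun_bound) (use D_le f in auto)
  moreover have "1 \<le> norm f"
    using norm_blinfun[of f x] x f \<open>D x = 1\<close> by simp
  ultimately show ?thesis using x f by (intro exI[of _ f]) (simp add: is_dual_def)
qed

text \<open>A dual functional is a subgradient of the norm at \<open>x\<close>: dividing the
  subgradient inequality by positive and by negative \<open>t\<close> bounds \<open>f h\<close> by
  \<open>d\<close> from both sides. This gives uniqueness and identifies \<open>J\<close> with the
  derivative of the norm on the sphere.\<close>

lemma is_dual_norm_derivative: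
  assumes f: "is_dual x f" and x: "norm x = 1"
    and lim: "((\<lambda>t. (norm (x + t *\<^sub>R h) - norm x) / t) \<longlongrightarrow> d) (at 0)"
  shows "blinfun_apply f h = d"
proof -
  have *: "t * f h \<le> norm (x + t *\<^sub>R h) - norm x" for t
  proof -
    have "f (x + t *\<^sub>R h) \<le> norm f * norm (x + t *\<^sub>R h)"
      using norm_blinfun[of f "x + t *\<^sub>R h"] by simp
    then show ?thesis using f x by (simp add: is_dual_def blinfun.add_right blinfun.scaleR_right)
  qed
  have "f h \<le> d"
  proof (rule tendsto_lowerbound)
    show "((\<lambda>t. (norm (x + t *\<^sub>R h) - norm x) / t) \<longlongrightarrow> d) (at_right 0)"
      by (rule filterlim_mono[OF lim]) (auto simp: at_le)
    show "\<forall>\<^sub>F t in at_right 0. f h \<le> (norm (x + t *\<^sub>R h) - norm x) / t"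
      using * by (auto simp: eventually_at_filter pos_le_divide_eq mult.commute)
  qed auto
  moreover have "d \<le> f h"
  proof (rule tendsto_upperbound)
    show "((\<lambda>t. (norm (x + t *\<^sub>R h) - norm x) / t) \<longlongrightarrow> d) (at_left 0)"
      by (rule filterlim_mono[OF lim]) (auto simp: at_le)
    show "\<forall>\<^sub>F t in at_left 0. (norm (x + t *\<^sub>R h) - norm x) / t \<le> f h"
      using * by (auto simp: eventually_at_filter neg_divide_le_eq mult.commute)
  qed auto
  ultimately show ?thesis by simp
qed

lemma null_comparison:
  assumes "(g \<longlongrightarrow> 0) G" and "\<And>n. norm (f n) \<le> g n"
  shows "(f \<longlongrightarrow> 0) G"
  by (rule Lim_null_comparison[OF _ assms(1)]) (simp add: assms(2))

locale smooth_two_convex =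
  fixes E :: "'a::banach itself"
  assumes smooth: "uniformly_smooth TYPE('a)"
    and convex2: "two_uniformly_convex TYPE('a)"
begin

abbreviation J :: "'a \<Rightarrow> ('a \<Rightarrow>\<^sub>L real)" where "J \<equiv> duality_map"

text \<open>Uniformity is extracted as a single nonzero step \<open>t\<close> that serves all pairs
  of unit vectors, the form in which it yields continuity of \<open>J\<close>.\<close>

lemma norm_derivative:
  obtains l where
    "\<And>x h :: 'a. norm x = 1 \<Longrightarrow> norm h = 1 \<Longrightarrow>
       ((\<lambda>t. (norm (x + t *\<^sub>R h) - norm x) / t) \<longlongrightarrow> l x h) (at 0)"
    "\<And>\<epsilon>. \<epsilon> > 0 \<Longrightarrow> \<exists>t. t \<noteq> 0 \<and> (\<forall>x h :: 'a. norm x = 1 \<longrightarrow> norm h = 1 \<longrightarrow>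
       \<bar>(norm (x + t *\<^sub>R h) - norm x) / t - l x h\<bar> < \<epsilon>)"
proof -
  obtain l where l: "uniform_limit (sphere (0 :: 'a) 1 \<times> sphere 0 1)
            (\<lambda>t (x, y). (norm (x + t *\<^sub>R y) - norm x) / t) l (at (0 :: real))"
    using smooth unfolding uniformly_smooth_def by blast
  show thesis
  proof (rule that[of "\<lambda>x h. l (x, h)"])
    fix x h :: 'a assume "norm x = 1" "norm h = 1"
    then show "((\<lambda>t. (norm (x + t *\<^sub>R h) - norm x) / t) \<longlongrightarrow> l (x, h)) (at 0)"
      using tendsto_uniform_limitI[OF l, of "(x, h)"] by simp
  next
    fix \<epsilon> :: real assume "\<epsilon> > 0"
    from uniform_limitD[OF l this]
    have ev: "\<forall>\<^sub>F t in at 0. \<forall>p\<in>sphere (0 :: 'a) 1 \<times> sphere 0 1.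
        dist (case p of (x, y) \<Rightarrow> (norm (x + t *\<^sub>R y) - norm x) / t) (l p) < \<epsilon>" .
    have "\<forall>\<^sub>F t :: real in at 0. t \<noteq> 0" by (simp add: eventually_at_filter)
    from eventually_happens[OF eventually_conj[OF this ev]]
    show "\<exists>t. t \<noteq> 0 \<and> (\<forall>x h :: 'a. norm x = 1 \<longrightarrow> norm h = 1 \<longrightarrow>
       \<bar>(norm (x + t *\<^sub>R h) - norm x) / t - l (x, h)\<bar> < \<epsilon>)"
      by (auto simp: dist_real_def)
  qed
qed

text \<open>Normalization reduces both halves to unit vectors, where the derivative of the norm is a
  dual functional and every dual functional equals it.\<close>

lemma is_dual_ex1: "\<exists>!f. is_dual (x::'a) f"
proof (cases "x = 0")
  case True
  then show ?thesis by (auto simp: is_dual_def)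
next
  case False
  define u where "u = x /\<^sub>R norm x"
  have u: "norm u = 1" "x = norm x *\<^sub>R u" using False by (auto simp: u_def)
  obtain l where "\<And>x h :: 'a. norm x = 1 \<Longrightarrow> norm h = 1 \<Longrightarrow>
       ((\<lambda>t. (norm (x + t *\<^sub>R h) - norm x) / t) \<longlongrightarrow> l x h) (at 0)"
    by (rule norm_derivative) (rule that)
  note l = this[OF u(1)]
  show ?thesis
  proof (rule ex_ex1I)
    have "\<exists>f. is_dual u f" by (rule dual_of_norm_derivative[OF u(1)]) (use l in blast)
    then show "\<exists>f. is_dual x f" using is_dual_scaleR u(2) by metis
  next
    fix f g assume "is_dual x f" "is_dual x g"
    then have d: "is_dual u (f /\<^sub>R norm x)" "is_dual u (g /\<^sub>R norm x)"
      unfolding u_def by (auto intro: is_dual_scaleR)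
    have "(f /\<^sub>R norm x) h = (g /\<^sub>R norm x) h" if "norm h = 1" for h
      using is_dual_norm_derivative[OF d(1) u(1) l] is_dual_norm_derivative[OF d(2) u(1) l] that
      by simp
    then have unit: "f h = g h" if "norm h = 1" for h
      using that False by (simp add: blinfun.scaleR_left)
    show "f = g"
    proof (rule blinfun_eqI)
      fix h
      show "f h = g h"
        using unit[of "h /\<^sub>R norm h"]
        by (cases "h = 0") (auto simp: blinfun.scaleR_right blinfun.zero_right)
    qed
  qed
qed

lemma is_dual_J: "is_dual (x::'a) (J x)"
proof -
  have "J x = (THE f. is_dual x f)"
    unfolding duality_map_def is_dual_def by (simp add: power2_eq_iff_nonneg)
  then show ?thesis using theI'[OF is_dual_ex1] by simp
qed

lemma J_self [simp]: "J x x = (norm x)\<^sup>2"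
  and norm_J [simp]: "norm (J x) = norm x"
  using is_dual_J[of x] by (auto simp: is_dual_def)

lemma J_eqI: "is_dual x f \<Longrightarrow> J x = f"
  using is_dual_ex1[of x] is_dual_J[of x] by blast

lemma J_scaleR: "J (r *\<^sub>R x) = r *\<^sub>R J x"
  by (intro J_eqI is_dual_scaleR is_dual_J)

lemma J_zero [simp]: "J 0 = 0"
  using J_scaleR[of 0 0] by simp

text \<open>One-sided bounds suffice because the unit sphere is symmetric. The condition
  \<open>0 \<le> B\<close> covers the zero space, which has no unit vectors.\<close>

lemma norm_blinfun_le_unit:
  fixes f :: "'a \<Rightarrow>\<^sub>L real"
  assumes "0 \<le> B" "\<And>h. norm h = 1 \<Longrightarrow> f h \<le> B"
  shows "norm f \<le> B"
proof (rule norm_blinfun_bound[OF assms(1)])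
  fix h
  show "norm (f h) \<le> B * norm h"
  proof (cases "h = 0")
    case True
    then show ?thesis by (simp add: blinfun.zero_right)
  next
    case False
    then have "f (h /\<^sub>R norm h) \<le> B" "f (- h /\<^sub>R norm h) \<le> B" using assms(2) by auto
    then show ?thesis using False
      by (simp add: blinfun.scaleR_right blinfun.minus_right field_simps abs_le_iff)
  qed
qed

text \<open>For one fixed \<open>t\<close> the difference quotient approximates \<open>J x h\<close>
  uniformly in \<open>x\<close> and \<open>h\<close>, and it is Lipschitz in \<open>x\<close> on the
  sphere.\<close>

lemma J_continuous_sphere: "continuous_on (sphere 0 1) J"
  unfolding continuous_on_iff
proof (intro ballI allI impI)
  fix x :: 'a and e :: real assume x: "x \<in> sphere 0 1" and "e > 0"
  obtain l where lim: "\<And>x h :: 'a. norm x = 1 \<Longrightarrow> norm h = 1 \<Longrightarrow>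
       ((\<lambda>t. (norm (x + t *\<^sub>R h) - norm x) / t) \<longlongrightarrow> l x h) (at 0)"
    and unif: "\<And>\<epsilon>. \<epsilon> > 0 \<Longrightarrow> \<exists>t. t \<noteq> 0 \<and> (\<forall>x h :: 'a. norm x = 1 \<longrightarrow> norm h = 1 \<longrightarrow>
       \<bar>(norm (x + t *\<^sub>R h) - norm x) / t - l x h\<bar> < \<epsilon>)"
    using norm_derivative by blast
  have Jl: "J x h = l x h" if "norm x = 1" "norm h = 1" for x h
    by (rule is_dual_norm_derivative[OF is_dual_J that(1) lim[OF that]])
  obtain t where "t \<noteq> 0"
    and t: "\<And>x h :: 'a. norm x = 1 \<Longrightarrow> norm h = 1 \<Longrightarrow>
       \<bar>(norm (x + t *\<^sub>R h) - norm x) / t - J x h\<bar> < e/4"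
    using unif[of "e/4"] \<open>e > 0\<close> Jl by fastforce
  show "\<exists>d>0. \<forall>x'\<in>sphere 0 1. dist x' x < d \<longrightarrow> dist (J x') (J x) < e"
  \<comment> \<open>At this distance the two quotients differ by at most \<open>e / 8\<close>; with
    two approximation errors of \<open>e / 4\<close> the total stays below
    \<open>3/4 * e\<close>.\<close>
  proof (intro exI[of _ "e * \<bar>t\<bar> / 8"] conjI ballI impI)
    show "0 < e * \<bar>t\<bar> / 8" using \<open>e > 0\<close> \<open>t \<noteq> 0\<close> by simp
  next
    fix x' :: 'a assume x': "x' \<in> sphere 0 1" and close: "dist x' x < e * \<bar>t\<bar> / 8"
    have "norm (J x' - J x) \<le> 3/4 * e"
    proof (rule norm_blinfun_le_unit)
      fix h :: 'a assume h: "norm h = 1"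
      have "\<bar>norm (x' + t *\<^sub>R h) - norm (x + t *\<^sub>R h)\<bar> \<le> norm (x' - x)"
        using norm_triangle_ineq3[of "x' + t *\<^sub>R h" "x + t *\<^sub>R h"] by simp
      then have n: "\<bar>(norm (x' + t *\<^sub>R h) - norm x') - (norm (x + t *\<^sub>R h) - norm x)\<bar> \<le> e * \<bar>t\<bar> / 8"
        using close x x' by (simp add: dist_norm)
      have "\<bar>(norm (x' + t *\<^sub>R h) - norm x') / t - (norm (x + t *\<^sub>R h) - norm x) / t\<bar>
          = \<bar>(norm (x' + t *\<^sub>R h) - norm x') - (norm (x + t *\<^sub>R h) - norm x)\<bar> / \<bar>t\<bar>"
        by (simp add: diff_divide_distrib flip: abs_divide)
      also have "\<dots> \<le> e / 8" using n \<open>t \<noteq> 0\<close> by (simp add: pos_divide_le_eq)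
      finally have "J x' h - J x h \<le> 3/4 * e"
        using t[OF _ h, of x] t[OF _ h, of x'] x x' \<open>e > 0\<close> unfolding mem_sphere_0 by linarith
      then show "(J x' - J x) h \<le> 3/4 * e" by (simp add: blinfun.diff_left)
    qed (use \<open>e > 0\<close> in auto)
    then show "dist (J x') (J x) < e" using \<open>e > 0\<close> by (simp add: dist_norm)
  qed
qed

text \<open>Homogeneity carries continuity from the sphere to all nonzero vectors; at 0 it follows
  from \<open>norm_J\<close>.\<close>

lemma J_continuous: "continuous_on UNIV J"
proof -
  have "isCont J x" for x
  proof (cases "x = 0")
    case True
    have "((\<lambda>y. norm (J y)) \<longlongrightarrow> 0) (at 0)" using tendsto_norm_zero[OF tendsto_ident_at] by simp
    then have "(J \<longlongrightarrow> 0) (at 0)" by (rule tendsto_norm_zero_cancel)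
    then show ?thesis using True by (simp add: isCont_def)
  next
    case False
    have eq: "norm y *\<^sub>R J (y /\<^sub>R norm y) = J y" for y
      by (cases "y = 0") (auto simp: J_scaleR)
    have "(\<lambda>y::'a. y /\<^sub>R norm y) ` (- {0}) \<subseteq> sphere 0 1" by (simp add: image_subset_iff)
    then have "continuous_on (- {0}) (\<lambda>y. norm y *\<^sub>R J (y /\<^sub>R norm y))"
      by (intro continuous_intros continuous_on_compose2[OF J_continuous_sphere]) auto
    then have "continuous_on (- {0}) J" unfolding eq .
    then show ?thesis using False by (simp add: continuous_on_eq_continuous_at open_Compl)
  qed
  then show ?thesis by (simp add: continuous_at_imp_continuous_on)
qed

lemma tendsto_J [tendsto_intros]: "(f \<longlongrightarrow> u) G \<Longrightarrow> ((\<lambda>n. J (f n)) \<longlongrightarrow> J u) G"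
  using continuous_on_tendsto_compose[OF J_continuous, of f u G] by simp

text \<open>Every functional attains its norm: midpoints of almost maximizing unit vectors have norm
  close to 1, so 2-uniform convexity makes a maximizing sequence Cauchy. Scaling its limit by
  \<open>norm f\<close> gives a preimage of \<open>f\<close>.\<close>

lemma J_surj: "surj J"
proof -
  have "\<exists>x. f = J x" for f :: "'a \<Rightarrow>\<^sub>L real"
  proof (cases "f = 0")
    case True
    then show ?thesis by (intro exI[of _ 0]) simp
  next
    case False
    then have nf: "norm f > 0" by simp
    obtain k where k: "k > 0"
      "\<And>x y :: 'a. norm x = 1 \<Longrightarrow> norm y = 1 \<Longrightarrow> norm (x + y) / 2 \<le> 1 - k * (norm (x - y))\<^sup>2"
      using two_uniformly_convex_unit[OF convex2] by blast
    have "\<exists>h. norm h = 1 \<and> norm f * (1 - inverse (real (Suc n))) < f h" for n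
    proof (rule ccontr)
      assume "\<not> ?thesis"
      then have "norm f \<le> norm f * (1 - inverse (real (Suc n)))"
        using nf by (intro norm_blinfun_le_unit) (auto simp: not_less field_simps)
      then show False using nf by (simp add: field_simps)
    qed
    then obtain h where h: "\<And>n. norm (h n) = 1"
      and fh: "\<And>n. norm f * (1 - inverse (real (Suc n))) < f (h n)" by metis
    have gap: "k * (norm (h m - h n))\<^sup>2 \<le> inverse (real (Suc N))" if "N \<le> m" "N \<le> n" for m n N
    proof -
      have "norm f * (1 - inverse (real (Suc N))) \<le> f (h i)" if "N \<le> i" for i
      proof -
        have "norm f * (1 - inverse (real (Suc N))) \<le> norm f * (1 - inverse (real (Suc i)))"
          using that by (intro mult_left_mono diff_left_mono le_imp_inverse_le) auto
        then show ?thesis using fh[of i] by simp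
      qed
      from this[OF that(1)] this[OF that(2)]
      have "norm f * (1 - inverse (real (Suc N))) \<le> f (h m + h n) / 2"
        by (simp add: blinfun.add_right)
      also have "\<dots> \<le> norm f * (norm (h m + h n) / 2)"
        using norm_blinfun[of f "h m + h n"] by simp
      finally have "1 - inverse (real (Suc N)) \<le> norm (h m + h n) / 2"
        using nf by (simp only: mult_le_cancel_left_pos)
      then show ?thesis using k(2)[OF h h, of m n] by linarith
    qed
    have "Cauchy h"
      unfolding Cauchy_def
    proof (intro allI impI)
      fix e :: real assume "e > 0"
      then obtain N where N: "inverse (real (Suc N)) < k * e\<^sup>2"
        using reals_Archimedean[of "k * e\<^sup>2"] k(1) by auto
      show "\<exists>N. \<forall>m\<ge>N. \<forall>n\<ge>N. dist (h m) (h n) < e"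
      proof (intro exI[of _ N] allI impI)
        fix m n assume "N \<le> m" "N \<le> n"
        then have "k * (norm (h m - h n))\<^sup>2 < k * e\<^sup>2" using gap[of N m n] N by linarith
        then show "dist (h m) (h n) < e"
          using k(1) \<open>e > 0\<close> by (auto simp: dist_norm intro: power2_less_imp_less)
      qed
    qed
    then obtain v where v: "h \<longlonglongrightarrow> v" using Cauchy_convergent convergent_def by blast
    have nv: "norm v = 1"
      using tendsto_norm[OF v] h by (simp add: LIMSEQ_const_iff)
    have "norm f \<le> f v"
    proof (rule LIMSEQ_le)
      show "(\<lambda>n. norm f * (1 - inverse (real (Suc n)))) \<longlonglongrightarrow> norm f"
        by (rule tendsto_eq_intros LIMSEQ_inverse_real_of_nat refl | simp)+
      show "(\<lambda>n. f (h n)) \<longlonglongrightarrow> f v" by (intro tendsto_intros v)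
    qed (use fh in \<open>auto intro: less_imp_le\<close>)
    then have "f v = norm f" using norm_blinfun[of f v] nv by simp
    then have "is_dual (norm f *\<^sub>R v) f"
      using nv by (simp add: is_dual_def blinfun.scaleR_right power2_eq_square)
    then show ?thesis using J_eqI by metis
  qed
  then show ?thesis by (auto simp: surj_def)
qed

lemma J_inv [simp]: "J (inv J f) = f"
  by (rule surj_f_inv_f[OF J_surj])

section \<open>The Lyapunov functional\<close>

lemma lyapunov_self [simp]: "lyapunov (x::'a) x = 0"
  by (simp add: lyapunov_def)

lemma lyapunov_nonneg: "0 \<le> lyapunov y (x::'a)"
proof -
  have "J x y \<le> norm x * norm y" using norm_blinfun[of "J x" y] by simp
  then show ?thesis
    using sum_squares_bound[of "norm x" "norm y"] by (simp add: lyapunov_def)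
qed

text \<open>For fixed \<open>x\<close>, \<open>lyapunov y x\<close> differs from the squared norm of
  \<open>y\<close> by an affine function of \<open>y\<close>, so the gap carries over
  unchanged.\<close>

lemma midpoint_gap_lyapunov:
  assumes "midpoint_gap TYPE('a) \<kappa>"
  shows "lyapunov ((1/2) *\<^sub>R (y + y')) (x::'a) + \<kappa> * (norm (y - y'))\<^sup>2
           \<le> (lyapunov y x + lyapunov y' x) / 2"
  using assms[unfolded midpoint_gap_def, rule_format, of y y']
  by (simp add: lyapunov_def blinfun.scaleR_right blinfun.add_right field_simps)

text \<open>The gap is taken at the midpoint of \<open>y\<close> and \<open>x\<close>: the
  functional vanishes at \<open>x\<close> and is nonnegative at the midpoint. Clearing the half
  doubles the constant.\<close>

lemma lyapunov_ge:
  obtains \<kappa> where "\<kappa> > 0" "\<And>x y :: 'a. \<kappa> * (norm (y - x))\<^sup>2 \<le> lyapunov y x"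
proof -
  obtain \<kappa> where \<kappa>: "\<kappa> > 0" "midpoint_gap TYPE('a) \<kappa>"
    using two_uniformly_convex_midpoint_gap[OF convex2] by blast
  show thesis
  proof (rule that)
    fix x y :: 'a
    show "(2 * \<kappa>) * (norm (y - x))\<^sup>2 \<le> lyapunov y x"
      using midpoint_gap_lyapunov[OF \<kappa>(2), of y x x] lyapunov_nonneg[of "(1/2) *\<^sub>R (y + x)" x]
      by simp
  qed (use \<kappa> in simp)
qed

text \<open>The sum \<open>lyapunov x y + lyapunov y x\<close> is twice the pairing of
  \<open>J x - J y\<close> with \<open>x - y\<close>, so the quadratic lower bound becomes strong
  monotonicity.\<close>

lemma J_strongly_monotone:
  obtains \<kappa> where "\<kappa> > 0" "\<And>x y :: 'a. \<kappa> * norm (x - y) \<le> norm (J x - J y)"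
proof -
  obtain \<kappa> where \<kappa>: "\<kappa> > 0" "\<And>x y :: 'a. \<kappa> * (norm (y - x))\<^sup>2 \<le> lyapunov y x"
    using lyapunov_ge by blast
  show thesis
  proof (rule that[OF \<kappa>(1)])
    fix x y :: 'a
    have "2 * (\<kappa> * norm (x - y) * norm (x - y)) \<le> lyapunov x y + lyapunov y x"
      using \<kappa>(2)[of x y] \<kappa>(2)[of y x] by (simp add: norm_minus_commute power2_eq_square)
    also have "\<dots> = 2 * (J x - J y) (x - y)"
      by (simp add: lyapunov_def blinfun.diff_left blinfun.diff_right)
    also have "\<dots> \<le> 2 * (norm (J x - J y) * norm (x - y))"
      using norm_blinfun[of "J x - J y" "x - y"] by simp
    finally have "\<kappa> * norm (x - y) * norm (x - y) \<le> norm (J x - J y) * norm (x - y)" by simp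
    then show "\<kappa> * norm (x - y) \<le> norm (J x - J y)"
      by (cases "x = y") (auto simp: mult_le_cancel_right)
  qed
qed

text \<open>The operator \<open>GREATEST\<close> is meaningful only if a greatest admissible
  constant exists. Strong monotonicity supplies one admissible constant, and the supremum is
  admissible because each pair \<open>x\<close>, \<open>y\<close> imposes a closed upper bound on
  the constant.\<close>

lemma two_convexity_c:
  defines "c \<equiv> two_convexity_c TYPE('a)"
  shows "0 < c" "norm (x - y :: 'a) \<le> 2 / c\<^sup>2 * norm (J x - J y)"
proof -
  define P where "P c \<longleftrightarrow> 0 < c \<and> c \<le> 1 \<and>
        (\<forall>x y :: 'a. norm (x - y) \<le> 2 / c\<^sup>2 * norm (J x - J y))" for c :: real
  obtain \<kappa> where \<kappa>: "\<kappa> > 0" "\<And>x y :: 'a. \<kappa> * norm (x - y) \<le> norm (J x - J y)"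
    using J_strongly_monotone by blast
  \<comment> \<open>Being at most 1 gives \<open>d\<^sup>2 \<le> d\<close>, and hence
    \<open>d\<^sup>2 \<le> \<kappa>\<close>.\<close>
  define d where "d = min 1 \<kappa>"
  have d: "0 < d" "d \<le> 1" "d\<^sup>2 \<le> 2 * \<kappa>"
  proof -
    show "0 < d" "d \<le> 1" using \<kappa> by (auto simp: d_def)
    then have "d\<^sup>2 \<le> d" by (simp add: power2_eq_square mult_left_le)
    moreover have "d \<le> \<kappa>" by (simp add: d_def)
    ultimately show "d\<^sup>2 \<le> 2 * \<kappa>" using \<kappa> by linarith
  qed
  have "P d"
    unfolding P_def
  proof (intro conjI allI d)
    fix x y :: 'a
    have "d\<^sup>2 * norm (x - y) \<le> 2 * \<kappa> * norm (x - y)" using d by (intro mult_right_mono) auto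
    also have "\<dots> \<le> 2 * norm (J x - J y)" using \<kappa>(2)[of x y] by simp
    finally show "norm (x - y) \<le> 2 / d\<^sup>2 * norm (J x - J y)" using d by (simp add: field_simps)
  qed
  define s where "s = Sup {c. P c}"
  have bdd: "bdd_above {c. P c}" by (auto simp: P_def intro!: bdd_aboveI[of _ 1])
  have le: "c' \<le> s" if "P c'" for c' using that bdd by (auto simp: s_def intro: cSup_upper)
  have s0: "s > 0" using le[OF \<open>P d\<close>] d by simp
  have "P s"
    unfolding P_def
  proof (intro conjI allI s0)
    show "s \<le> 1" unfolding s_def by (rule cSup_least) (use \<open>P d\<close> in \<open>auto simp: P_def\<close>)
    fix x y :: 'a
    have "s \<le> sqrt (2 * norm (J x - J y) / norm (x - y))" if "x \<noteq> y"
      unfolding s_def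
    proof (rule cSup_least)
      fix c' assume "c' \<in> {c. P c}"
      then have c': "0 < c'" "norm (x - y) \<le> 2 / c'\<^sup>2 * norm (J x - J y)" by (auto simp: P_def)
      then have "c'\<^sup>2 \<le> 2 * norm (J x - J y) / norm (x - y)" using that by (simp add: field_simps)
      then show "c' \<le> sqrt (2 * norm (J x - J y) / norm (x - y))" by (rule real_le_rsqrt)
    qed (use \<open>P d\<close> in auto)
    then have "s\<^sup>2 \<le> (sqrt (2 * norm (J x - J y) / norm (x - y)))\<^sup>2" if "x \<noteq> y"
      using that s0 by (intro power_mono) auto
    then have "s\<^sup>2 \<le> 2 * norm (J x - J y) / norm (x - y)" if "x \<noteq> y"
      using that by simp
    then show "norm (x - y) \<le> 2 / s\<^sup>2 * norm (J x - J y)"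
      using s0 by (cases "x = y") (auto simp: field_simps)
  qed
  have "c = (GREATEST c. P c)" by (simp add: c_def two_convexity_c_def P_def)
  also have "\<dots> = s" by (rule Greatest_equality) (use \<open>P s\<close> le in auto)
  finally have "P c" using \<open>P s\<close> by simp
  then show "0 < c" "norm (x - y) \<le> 2 / c\<^sup>2 * norm (J x - J y)" by (auto simp: P_def)
qed

lemma tendsto_of_tendsto_J:
  assumes "((\<lambda>n. J (f n)) \<longlongrightarrow> J u) G"
  shows "(f \<longlongrightarrow> u) G"
proof -
  obtain \<kappa> where \<kappa>: "\<kappa> > 0" "\<And>x y :: 'a. \<kappa> * norm (x - y) \<le> norm (J x - J y)"
    using J_strongly_monotone by blast
  have "((\<lambda>n. norm (J (f n) - J u) / \<kappa>) \<longlongrightarrow> 0) G"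
    using tendsto_divide[OF tendsto_norm_zero[OF LIM_zero[OF assms]] tendsto_const, of \<kappa>] \<kappa>(1)
    by simp
  moreover have "norm (f n - u) \<le> norm (J (f n) - J u) / \<kappa>" for n
    using \<kappa>(1) \<kappa>(2)[of "f n" u] by (simp add: field_simps)
  ultimately have "((\<lambda>n. f n - u) \<longlongrightarrow> 0) G" by (rule null_comparison)
  then show ?thesis by (simp add: LIM_zero_iff)
qed

lemma lyapunov_tendsto_zeroD:
  assumes "((\<lambda>n. lyapunov (f n) (g n)) \<longlongrightarrow> 0) G"
  shows "((\<lambda>n. f n - g n :: 'a) \<longlongrightarrow> 0) G"
proof -
  obtain \<kappa> where \<kappa>: "\<kappa> > 0" "\<And>x y :: 'a. \<kappa> * (norm (y - x))\<^sup>2 \<le> lyapunov y x"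
    using lyapunov_ge by blast
  have "((\<lambda>n. sqrt (lyapunov (f n) (g n) / \<kappa>)) \<longlongrightarrow> 0) G"
    using tendsto_real_sqrt[OF tendsto_divide[OF assms tendsto_const, of \<kappa>]] \<kappa>(1) by simp
  moreover have "norm (f n - g n) \<le> sqrt (lyapunov (f n) (g n) / \<kappa>)" for n
    using \<kappa>(1) \<kappa>(2)[of "f n" "g n"] by (intro real_le_rsqrt) (simp add: field_simps)
  ultimately show ?thesis by (rule null_comparison)
qed

lemma tendsto_lyapunov [tendsto_intros]:
  assumes "(f \<longlongrightarrow> u) G" "(g \<longlongrightarrow> v) G"
  shows "((\<lambda>n. lyapunov (f n) (g n :: 'a)) \<longlongrightarrow> lyapunov u v) G"
  unfolding lyapunov_def by (intro tendsto_intros assms)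

lemma lyapunov_eq_0_imp_eq: "lyapunov x y = 0 \<Longrightarrow> x = (y::'a)"
  using lyapunov_tendsto_zeroD[of "\<lambda>_. x" "\<lambda>_. y" sequentially] by (simp add: LIMSEQ_const_iff)

section \<open>The generalized projection\<close>

text \<open>The midpoint of two almost minimizing points stays in \<open>D\<close>, where the value
  is at least \<open>m\<close>; the gap therefore makes a minimizing sequence Cauchy.\<close>

lemma lyapunov_minimizer:
  fixes D :: "'a set"
  assumes D: "D \<noteq> {}" "closed D" "convex D"
  shows "\<exists>p. is_arg_min (\<lambda>y. lyapunov y x) (\<lambda>y. y \<in> D) p"
proof -
  obtain \<kappa> where \<kappa>: "\<kappa> > 0" "midpoint_gap TYPE('a) \<kappa>"
    using two_uniformly_convex_midpoint_gap[OF convex2] by blast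
  define m where "m = (INF y\<in>D. lyapunov y x)"
  have bdd: "bdd_below ((\<lambda>y. lyapunov y x) ` D)" by (rule bdd_belowI2[of _ 0]) (rule lyapunov_nonneg)
  have m: "m \<le> lyapunov y x" if "y \<in> D" for y
    unfolding m_def using that bdd by (rule cINF_lower[rotated])
  have "\<exists>y\<in>D. lyapunov y x < m + inverse (real (Suc n))" for n
  proof (rule ccontr)
    assume "\<not> ?thesis"
    then have "m + inverse (real (Suc n)) \<le> m"
      unfolding m_def by (intro cINF_greatest) (use D in \<open>auto simp: m_def not_less\<close>)
    then show False by simp
  qed
  then obtain h where h: "\<And>n. h n \<in> D" and hm: "\<And>n. lyapunov (h n) x < m + inverse (real (Suc n))"
    by metis
  have gap: "\<kappa> * (norm (h i - h n))\<^sup>2 \<le> inverse (real (Suc N))" if "N \<le> i" "N \<le> n" for i n N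
  proof -
    have *: "lyapunov (h i) x \<le> m + inverse (real (Suc N))" if "N \<le> i" for i
    proof -
      have "inverse (real (Suc i)) \<le> inverse (real (Suc N))"
        using that by (intro le_imp_inverse_le) auto
      then show ?thesis using hm[of i] by linarith
    qed
    have "(1/2) *\<^sub>R (h i + h n) \<in> D"
      using convexD[OF D(3) h h, of "1/2" "1/2" i n] by (simp add: scaleR_add_right)
    from m[OF this] have "\<kappa> * (norm (h i - h n))\<^sup>2 \<le> (lyapunov (h i) x + lyapunov (h n) x) / 2 - m"
      using midpoint_gap_lyapunov[OF \<kappa>(2), of "h i" "h n" x] by linarith
    also have "\<dots> \<le> inverse (real (Suc N))"
      using *[OF that(1)] *[OF that(2)] by (simp add: field_simps)
    finally show ?thesis .
  qed
  have "Cauchy h"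
    unfolding Cauchy_def
  proof (intro allI impI)
    fix e :: real assume "e > 0"
    then obtain N where N: "inverse (real (Suc N)) < \<kappa> * e\<^sup>2"
      using reals_Archimedean[of "\<kappa> * e\<^sup>2"] \<kappa>(1) by auto
    show "\<exists>N. \<forall>i\<ge>N. \<forall>n\<ge>N. dist (h i) (h n) < e"
    proof (intro exI[of _ N] allI impI)
      fix i n assume "N \<le> i" "N \<le> n"
      then have "\<kappa> * (norm (h i - h n))\<^sup>2 < \<kappa> * e\<^sup>2" using gap[of N i n] N by linarith
      then show "dist (h i) (h n) < e"
        using \<kappa>(1) \<open>e > 0\<close> by (auto simp: dist_norm intro: power2_less_imp_less)
    qed
  qed
  then obtain p where p: "h \<longlonglongrightarrow> p" using Cauchy_convergent convergent_def by blast
  then have "p \<in> D" using closed_sequentially[OF D(2)] h by blast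
  moreover have "lyapunov p x \<le> m"
  proof (rule LIMSEQ_le)
    show "(\<lambda>n. lyapunov (h n) x) \<longlonglongrightarrow> lyapunov p x" by (intro tendsto_intros p)
    show "(\<lambda>n. m + inverse (real (Suc n))) \<longlonglongrightarrow> m"
      using tendsto_add[OF tendsto_const LIMSEQ_inverse_real_of_nat, of m] by simp
  qed (use hm in \<open>auto intro: less_imp_le\<close>)
  ultimately show ?thesis using m by (fastforce simp: is_arg_min_linorder)
qed

context
  fixes D :: "'a set"
  assumes D: "D \<noteq> {}" "closed D" "convex D"
begin

lemma gen_proj_mem: "gen_proj D x \<in> D"
  and gen_proj_le: "y \<in> D \<Longrightarrow> lyapunov (gen_proj D x) x \<le> lyapunov y x"
proof -
  have "is_arg_min (\<lambda>y. lyapunov y x) (\<lambda>y. y \<in> D) (gen_proj D x)"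
    unfolding gen_proj_def arg_min_on_def arg_min_def
    using lyapunov_minimizer[OF D] by (rule someI_ex)
  then show "gen_proj D x \<in> D" "y \<in> D \<Longrightarrow> lyapunov (gen_proj D x) x \<le> lyapunov y x"
    by (auto simp: is_arg_min_linorder)
qed

text \<open>First-order optimality without differentiating \<open>lyapunov\<close>: minimality is
  compared with \<open>0 \<le> lyapunov p (pt n)\<close>, the gradient inequality for the squared
  norm at the perturbed point. Continuity of \<open>J\<close> then lets the perturbation tend to
  0.\<close>

lemma gen_proj_variational:
  assumes y: "y \<in> D"
  shows "(J x - J (gen_proj D x)) (y - gen_proj D x) \<le> 0"
proof -
  define p where "p = gen_proj D x"
  define h where "h = y - p"
  define pt where "pt n = p + inverse (real (Suc n)) *\<^sub>R h" for n
  have "(J x - J (pt n)) h \<le> 0" for n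
  proof -
    define t where "t = inverse (real (Suc n))"
    have t: "0 < t" "t \<le> 1" by (auto simp: t_def inverse_le_1_iff)
    have pt: "pt n = p + t *\<^sub>R h" by (simp add: pt_def t_def)
    have "pt n = (1 - t) *\<^sub>R p + t *\<^sub>R y" by (simp add: pt h_def algebra_simps)
    then have "pt n \<in> D" using t y gen_proj_mem convexD_alt[OF D(3)] by (simp add: p_def)
    then have 1: "lyapunov p x \<le> lyapunov (pt n) x" unfolding p_def by (rule gen_proj_le)
    have "0 \<le> lyapunov p (pt n)" by (rule lyapunov_nonneg)
    moreover have "J (pt n) p = (norm (pt n))\<^sup>2 - t * J (pt n) h"
    proof -
      have "p = pt n - t *\<^sub>R h" by (simp add: pt)
      then have "J (pt n) p = J (pt n) (pt n - t *\<^sub>R h)" by simp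
      then show ?thesis by (simp add: blinfun.diff_right blinfun.scaleR_right)
    qed
    moreover have "J x (pt n) = J x p + t * J x h"
      by (simp add: pt blinfun.add_right blinfun.scaleR_right)
    ultimately have "t * J x h \<le> t * J (pt n) h" using 1 by (simp add: lyapunov_def)
    then show ?thesis using t by (simp add: blinfun.diff_left)
  qed
  moreover have "(\<lambda>n. (J x - J (pt n)) h) \<longlonglongrightarrow> (J x - J p) h"
  proof -
    have "pt \<longlonglongrightarrow> p + 0 *\<^sub>R h"
      unfolding pt_def by (intro tendsto_intros LIMSEQ_inverse_real_of_nat)
    then show ?thesis by (auto intro!: tendsto_intros)
  qed
  ultimately show ?thesis
    unfolding p_def[symmetric] h_def[symmetric] by (intro LIMSEQ_le_const2) auto
qed

text \<open>Left side minus right side is exactly twice the pairing in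
  \<open>gen_proj_variational\<close>.\<close>

lemma gen_proj_three_point:
  assumes "y \<in> D"
  shows "lyapunov y (gen_proj D x) + lyapunov (gen_proj D x) x \<le> lyapunov y x"
  using gen_proj_variational[OF assms, of x]
  by (simp add: lyapunov_def blinfun.diff_left blinfun.diff_right)

end

text \<open>The difference of the two sides is \<open>lyapunov w x\<close>.\<close>

lemma lyapunov_dual_step:
  assumes "J w = J x - g"
  shows "lyapunov u w \<le> lyapunov u x - 2 * g (w - u)"
proof -
  have g: "g = J x - J w" using assms by simp
  show ?thesis using lyapunov_nonneg[of w x]
    by (simp add: g lyapunov_def blinfun.diff_left blinfun.diff_right)
qed

text \<open>In terms of the dual vector \<open>J w\<close>, the pairing is linear and the squared
  norm is convex.\<close>

lemma lyapunov_dual_convex: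
  assumes t: "t \<in> {0..1}" and w: "J w = t *\<^sub>R J x + (1 - t) *\<^sub>R J y"
  shows "lyapunov u w \<le> t * lyapunov u x + (1 - t) * lyapunov u y"
proof -
  have "norm w = norm (t *\<^sub>R J x + (1 - t) *\<^sub>R J y)" using norm_J[of w] w by simp
  also have "\<dots> \<le> t * norm x + (1 - t) * norm y"
    using t norm_triangle_ineq[of "t *\<^sub>R J x" "(1 - t) *\<^sub>R J y"] by simp
  finally have "(norm w)\<^sup>2 \<le> (t * norm x + (1 - t) * norm y)\<^sup>2" by (intro power_mono) auto
  also have "\<dots> = t * (norm x)\<^sup>2 + (1 - t) * (norm y)\<^sup>2 - t * (1 - t) * (norm x - norm y)\<^sup>2"
    by (simp add: power2_eq_square algebra_simps)
  also have "\<dots> \<le> t * (norm x)\<^sup>2 + (1 - t) * (norm y)\<^sup>2" using t by simp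
  finally show ?thesis
    by (simp add: lyapunov_def w blinfun.add_left blinfun.scaleR_left)
      (simp add: algebra_simps)
qed

end

section \<open>Closed convex sets of solutions\<close>

text \<open>Taking \<open>p = u\<close> in the assumption forces \<open>A u = 0\<close>; conversely
  a zero solves the inequality trivially.\<close>

lemma VI_eq_zeros:
  assumes "\<And>p u. p \<in> C \<Longrightarrow> u \<in> VI A C \<Longrightarrow> norm (A p) \<le> norm (A p - A u)"
  shows "VI A C = {p \<in> C. A p = 0}"
proof
  show "VI A C \<subseteq> {p \<in> C. A p = 0}"
    using assms by (fastforce simp: VI_def)
  show "{p \<in> C. A p = 0} \<subseteq> VI A C" by (auto simp: VI_def)
qed

context
  fixes C :: "'a::real_normed_vector set" and \<alpha> :: real and A :: "'a \<Rightarrow> ('a \<Rightarrow>\<^sub>L real)"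
  assumes ism: "inverse_strongly_monotone_on C \<alpha> A" and \<alpha>: "0 < \<alpha>"
begin

lemma inverse_strongly_monotone_lipschitz:
  assumes "x \<in> C" "y \<in> C"
  shows "norm (A x - A y) \<le> norm (x - y) / \<alpha>"
proof (cases "A x = A y")
  case True
  then show ?thesis using \<alpha> by simp
next
  case False
  have "\<alpha> * norm (A x - A y) * norm (A x - A y) \<le> (A x - A y) (x - y)"
    using ism assms by (simp add: inverse_strongly_monotone_on_def power2_eq_square mult.assoc)
  also have "\<dots> \<le> norm (x - y) * norm (A x - A y)"
    using norm_blinfun[of "A x - A y" "x - y"] by (simp add: mult.commute)
  finally have "\<alpha> * norm (A x - A y) \<le> norm (x - y)" using False by (simp add: mult_le_cancel_right)
  then show ?thesis using \<alpha> by (simp add: field_simps)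
qed

lemma inverse_strongly_monotone_tendsto:
  assumes "\<And>n. \<xi> n \<in> C" "u \<in> C" "\<xi> \<longlonglongrightarrow> u"
  shows "(\<lambda>n. A (\<xi> n)) \<longlonglongrightarrow> A u"
proof -
  have "(\<lambda>n. norm (\<xi> n - u) / \<alpha>) \<longlonglongrightarrow> 0"
    using tendsto_divide[OF tendsto_norm_zero[OF LIM_zero[OF assms(3)]] tendsto_const, of \<alpha>] \<alpha> by simp
  then have "(\<lambda>n. A (\<xi> n) - A u) \<longlonglongrightarrow> 0"
    by (rule null_comparison) (use inverse_strongly_monotone_lipschitz assms in auto)
  then show ?thesis by (simp add: LIM_zero_iff)
qed

lemma inverse_strongly_monotone_zeros_closed:
  assumes "closed C"
  shows "closed {p \<in> C. A p = 0}"
  unfolding closed_sequential_limits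
proof (intro allI impI, elim conjE)
  fix \<xi> l assume \<xi>: "\<forall>n. \<xi> n \<in> {p \<in> C. A p = 0}" "\<xi> \<longlonglongrightarrow> l"
  then have "l \<in> C" using assms unfolding closed_sequential_limits by blast
  moreover from this have "(\<lambda>n. A (\<xi> n)) \<longlonglongrightarrow> A l"
    using \<xi> by (intro inverse_strongly_monotone_tendsto) auto
  ultimately show "l \<in> {p \<in> C. A p = 0}" using \<xi>(1) by (simp add: LIMSEQ_const_iff)
qed

text \<open>Testing against the zeros \<open>p\<close> and \<open>q\<close> bounds
  \<open>\<alpha> * (norm (A w))\<^sup>2\<close> by \<open>A w (w - p)\<close> and by
  \<open>A w (w - q)\<close>, whose weighted mean vanishes.\<close>

lemma inverse_strongly_monotone_zeros_convex:
  assumes "convex C"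
  shows "convex {p \<in> C. A p = 0}"
proof (rule convexI)
  fix p q :: 'a and s t :: real
  assume pq: "p \<in> {p \<in> C. A p = 0}" "q \<in> {p \<in> C. A p = 0}" and st: "0 \<le> s" "0 \<le> t" "s + t = 1"
  define w where "w = s *\<^sub>R p + t *\<^sub>R q"
  have w: "w \<in> C" using pq st assms by (auto simp: w_def intro: convexD)
  have *: "\<alpha> * (norm (A w))\<^sup>2 \<le> A w (w - r)" if "r \<in> {p, q}" for r
  proof -
    have "r \<in> C" "A r = 0" using that pq by auto
    then show ?thesis using ism w unfolding inverse_strongly_monotone_on_def by fastforce
  qed
  have "\<alpha> * (norm (A w))\<^sup>2 = s * (\<alpha> * (norm (A w))\<^sup>2) + t * (\<alpha> * (norm (A w))\<^sup>2)"
    using st(3) by (metis distrib_right mult_1)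
  also have "\<dots> \<le> s * A w (w - p) + t * A w (w - q)"
    using st * by (intro add_mono mult_left_mono) auto
  also have "\<dots> = A w ((s + t) *\<^sub>R w - w)"
    unfolding scaleR_add_left by (simp add: w_def blinfun.diff_right blinfun.add_right blinfun.scaleR_right algebra_simps)
  also have "\<dots> = 0" using st by simp
  finally have "A w = 0" using \<alpha> by (simp add: mult_le_0_iff)
  then show "s *\<^sub>R p + t *\<^sub>R q \<in> {p \<in> C. A p = 0}" using w by (simp add: w_def)
qed

end

lemma closed_mapping_fixed_points_closed:
  assumes "closed C" "closed_mapping_on C T"
  shows "closed (fixed_points_on C T)"
  unfolding closed_sequential_limits
proof (intro allI impI, elim conjE)
  fix \<xi> l assume \<xi>: "\<forall>n. \<xi> n \<in> fixed_points_on C T" "\<xi> \<longlonglongrightarrow> l"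
  then have C: "\<forall>n. \<xi> n \<in> C" and eq: "(\<lambda>n. T (\<xi> n)) = \<xi>" by (auto simp: fixed_points_on_def)
  have "l \<in> C" using assms(1) C \<xi>(2) unfolding closed_sequential_limits by blast
  moreover have "T l = l" using assms(2) C \<xi>(2) eq unfolding closed_mapping_on_def by metis
  ultimately show "l \<in> fixed_points_on C T" by (simp add: fixed_points_on_def)
qed

context smooth_two_convex
begin

text \<open>The value \<open>lyapunov w v\<close> differs from the weighted mean of
  \<open>lyapunov p v\<close> and \<open>lyapunov q v\<close> by a term independent of
  \<open>v\<close>. The inequality at \<open>p\<close> and \<open>q\<close> therefore passes to
  \<open>w\<close>, and \<open>lyapunov w w = 0\<close> leaves no room.\<close>

lemma quasi_phi_nonexpansive_fixed_points_convex:
  fixes C :: "'a set"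
  assumes "convex C" "quasi_phi_nonexpansive_on C T"
  shows "convex (fixed_points_on C T)"
proof (rule convexI)
  fix p q :: 'a and s t :: real
  assume pq: "p \<in> fixed_points_on C T" "q \<in> fixed_points_on C T" and st: "0 \<le> s" "0 \<le> t" "s + t = 1"
  define w where "w = s *\<^sub>R p + t *\<^sub>R q"
  have w: "w \<in> C" using pq st assms(1) by (auto simp: w_def fixed_points_on_def intro: convexD)
  have comb: "lyapunov w v = s * lyapunov p v + t * lyapunov q v
      + ((norm w)\<^sup>2 - s * (norm p)\<^sup>2 - t * (norm q)\<^sup>2)" for v
  proof -
    have "(norm v)\<^sup>2 = s * (norm v)\<^sup>2 + t * (norm v)\<^sup>2"
      using st(3) by (metis distrib_right mult_1)
    moreover have "J v w = s * J v p + t * J v q"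
      by (simp add: w_def blinfun.add_right blinfun.scaleR_right)
    ultimately show ?thesis by (simp add: lyapunov_def algebra_simps)
  qed
  have "s * lyapunov p (T w) + t * lyapunov q (T w) \<le> s * lyapunov p w + t * lyapunov q w"
    using assms(2) pq w st unfolding quasi_phi_nonexpansive_on_def
    by (intro add_mono mult_left_mono) auto
  then have "lyapunov w (T w) \<le> lyapunov w w" unfolding comb by simp
  then have "lyapunov w (T w) = 0" using lyapunov_nonneg[of w "T w"] by simp
  then have "T w = w" using lyapunov_eq_0_imp_eq by metis
  then show "s *\<^sub>R p + t *\<^sub>R q \<in> fixed_points_on C T" using w by (simp add: w_def fixed_points_on_def)
qed

section \<open>The forward step and Fejer monotone sequences\<close>

context
  fixes c l :: real and g :: "'a \<Rightarrow>\<^sub>L real" and w x :: 'a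
  assumes c: "\<And>x y :: 'a. norm (x - y) \<le> 2 / c\<^sup>2 * norm (J x - J y)"
    and w: "J w = J x - l *\<^sub>R g" and l: "0 \<le> l"
begin

lemma forward_step_displacement: "norm (w - x) \<le> 2 / c\<^sup>2 * (l * norm (g))"
  using c[of w x] l by (simp add: w)

lemma forward_step_pairing: "- g (w - x) \<le> 2 / c\<^sup>2 * l * (norm (g))\<^sup>2"
proof -
  have "- g (w - x) \<le> norm (g) * norm (w - x)"
    using norm_blinfun[of "g" "w - x"] by simp
  also have "\<dots> \<le> norm (g) * (2 / c\<^sup>2 * (l * norm (g)))"
    by (intro mult_left_mono forward_step_displacement) auto
  finally show ?thesis by (simp add: power2_eq_square mult_ac)
qed

lemma lyapunov_forward_step_self: "lyapunov x w \<le> 4 / c\<^sup>2 * l\<^sup>2 * (norm (g))\<^sup>2"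
proof -
  have "lyapunov x w \<le> 2 * l * (- g (w - x))"
    using lyapunov_dual_step[OF w, of x] by (simp add: blinfun.scaleR_left)
  also have "\<dots> \<le> 2 * l * (2 / c\<^sup>2 * l * (norm (g))\<^sup>2)"
    using l by (intro mult_left_mono forward_step_pairing) auto
  finally show ?thesis by (simp add: power2_eq_square mult_ac)
qed

text \<open>In \<open>A x (w - q)\<close>, the part with \<open>x - q\<close> is bounded below by
  inverse strong monotonicity and the part with \<open>w - x\<close> by
  \<open>forward_step_pairing\<close>. For \<open>0 < l < \<alpha> * c\<^sup>2 / 2\<close> the
  coefficient of the loss is positive.\<close>

lemma lyapunov_forward_step:
  assumes g: "g = A x" and ism: "inverse_strongly_monotone_on C \<alpha> A" and "x \<in> C" "q \<in> C" "A q = 0"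
  shows "lyapunov q w \<le> lyapunov q x - 2 * l * (\<alpha> - 2 * l / c\<^sup>2) * (norm (A x))\<^sup>2"
proof -
  have "\<alpha> * (norm (A x - A q))\<^sup>2 \<le> (A x - A q) (x - q)"
    using ism assms unfolding inverse_strongly_monotone_on_def by blast
  then have "\<alpha> * (norm (A x))\<^sup>2 \<le> A x (x - q)" using assms by simp
  then have "(\<alpha> - 2 * l / c\<^sup>2) * (norm (A x))\<^sup>2 \<le> A x (w - q)"
    using forward_step_pairing unfolding g by (simp add: blinfun.diff_right algebra_simps)
  then have "2 * l * ((\<alpha> - 2 * l / c\<^sup>2) * (norm (A x))\<^sup>2) \<le> 2 * l * A x (w - q)"
    using l by (intro mult_left_mono) auto
  moreover have "lyapunov q w \<le> lyapunov q x - 2 * l * A x (w - q)"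
    using lyapunov_dual_step[OF w, of q] by (simp add: g blinfun.scaleR_left)
  ultimately show ?thesis unfolding mult.assoc by linarith
qed

end

text \<open>The difference \<open>lyapunov q x - lyapunov q x'\<close> is affine in \<open>q\<close>
  with linear part \<open>- 2 * (J x - J x') q\<close>. Its nonnegativity at
  \<open>q = p + r *\<^sub>R h\<close> bounds the slope in direction \<open>h\<close>.\<close>

lemma duality_step_bound:
  assumes r: "0 < r" and le: "\<And>q. q \<in> cball p r \<Longrightarrow> lyapunov q x' \<le> lyapunov q (x::'a)"
  shows "norm (J x - J x') \<le> (lyapunov p x - lyapunov p x') / (2 * r)"
proof (rule norm_blinfun_le_unit)
  show "0 \<le> (lyapunov p x - lyapunov p x') / (2 * r)" using r le[of p] by simp
  fix h :: 'a assume h: "norm h = 1"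
  then have "p + r *\<^sub>R h \<in> cball p r" using r by (simp add: dist_norm)
  from le[OF this] have "(J x - J x') h * (2 * r) \<le> lyapunov p x - lyapunov p x'"
    by (simp add: lyapunov_def blinfun.add_right blinfun.scaleR_right blinfun.diff_left algebra_simps)
  then show "(J x - J x') h \<le> (lyapunov p x - lyapunov p x') / (2 * r)"
    using r by (simp add: pos_le_divide_eq)
qed

text \<open>The steps of \<open>J (x n)\<close> are dominated by the decrements of a decreasing
  nonnegative sequence, so they telescope to a Cauchy estimate in the dual.\<close>

lemma fejer_monotone_convergent:
  assumes "interior F \<noteq> {}"
    and le: "\<And>q n. q \<in> F \<Longrightarrow> lyapunov q (x (Suc n)) \<le> lyapunov q (x n :: 'a)"
  shows "convergent x"
proof -
  obtain p r where r: "r > 0" "cball p r \<subseteq> F"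
    using assms(1) by (auto simp: mem_interior_cball)
  define f where "f n = lyapunov p (x n) / (2 * r)" for n
  have step: "norm (J (x n) - J (x (Suc n))) \<le> f n - f (Suc n)" for n
    unfolding f_def diff_divide_distrib[symmetric]
    by (rule duality_step_bound[OF r(1)], rule le) (use r(2) in blast)
  have bound: "norm (J (x n) - J (x (n + k))) \<le> f n - f (n + k)" for n k
  proof (induction k)
    case (Suc k)
    have "norm (J (x n) - J (x (n + Suc k)))
        \<le> norm (J (x n) - J (x (n + k))) + norm (J (x (n + k)) - J (x (Suc (n + k))))"
      using dist_triangle[of "J (x n)" "J (x (n + Suc k))" "J (x (n + k))"] by (simp add: dist_norm)
    then show ?case using Suc step[of "n + k"] by simp
  qed simp
  have "decseq f" by (rule decseq_SucI) (use order_trans[OF norm_ge_zero step] in simp)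
  moreover have "0 \<le> f n" for n using lyapunov_nonneg r by (simp add: f_def)
  ultimately have "Cauchy f"
    using decseq_convergent[of f 0] by (blast intro: LIMSEQ_imp_Cauchy)
  have "Cauchy (\<lambda>n. J (x n))"
    unfolding Cauchy_altdef
  proof (intro allI impI)
    fix e :: real assume "e > 0"
    then obtain K where K: "\<And>m n. m \<ge> K \<Longrightarrow> n > m \<Longrightarrow> dist (f m) (f n) < e"
      using \<open>Cauchy f\<close> unfolding Cauchy_altdef by blast
    show "\<exists>K. \<forall>m\<ge>K. \<forall>n>m. dist (J (x m)) (J (x n)) < e"
    proof (intro exI[of _ K] allI impI)
      fix m n assume mn: "K \<le> m" "m < n"
      then show "dist (J (x m)) (J (x n)) < e"
        using bound[of m "n - m"] K[OF mn] by (simp add: dist_norm)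
    qed
  qed
  then obtain g where "(\<lambda>n. J (x n)) \<longlonglongrightarrow> g" using Cauchy_convergent convergent_def by blast
  \<comment> \<open>Surjectivity of \<open>J\<close> names the candidate limit in the original
    space.\<close>
  then have "(\<lambda>n. J (x n)) \<longlonglongrightarrow> J (inv J g)" by simp
  then have "x \<longlonglongrightarrow> inv J g" by (rule tendsto_of_tendsto_J)
  then show ?thesis by (rule convergentI)
qed

end

theorem theorem4p1:
  fixes C F :: "'a::banach set"
    and A :: "nat \<Rightarrow> 'a \<Rightarrow> ('a \<Rightarrow>\<^sub>L real)"
    and S :: "nat \<Rightarrow> 'a \<Rightarrow> 'a"
    and M N :: nat
    and \<alpha> a b c :: real
    and \<alpha>s lam :: "nat \<Rightarrow> real"
    and x ybar zbar :: "nat \<Rightarrow> 'a"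
    and y z :: "nat \<Rightarrow> nat \<Rightarrow> 'a"
    and i j :: "nat \<Rightarrow> nat"
  assumes "uniformly_smooth TYPE('a)"
    and "two_uniformly_convex TYPE('a)"
    and "C \<noteq> {}" and "closed C" and "convex C"
    and "1 \<le> M" and "1 \<le> N"
    and "0 < \<alpha>"
    and V1: "\<And>k. k \<in> {1..M} \<Longrightarrow> inverse_strongly_monotone_on C \<alpha> (A k)"
    and V2: "\<And>k. k \<in> {1..M} \<Longrightarrow> VI (A k) C \<noteq> {}"
    and V3: "\<And>k p u. k \<in> {1..M} \<Longrightarrow> p \<in> C \<Longrightarrow> u \<in> VI (A k) C \<Longrightarrow>
               norm (A k p) \<le> norm (A k p - A k u)"
    and S_self: "\<And>k. k \<in> {1..N} \<Longrightarrow> S k ` C \<subseteq> C"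
    and S_closed: "\<And>k. k \<in> {1..N} \<Longrightarrow> closed_mapping_on C (S k)"
    and S_quasi: "\<And>k. k \<in> {1..N} \<Longrightarrow> quasi_phi_nonexpansive_on C (S k)"
    and "\<And>n. \<alpha>s n \<in> {0..1}" and "\<alpha>s \<longlonglongrightarrow> 0"
    and c_def: "c = two_convexity_c TYPE('a)"
    and "a \<in> {0<..<\<alpha> * c\<^sup>2 / 2}" and "b \<in> {0<..<\<alpha> * c\<^sup>2 / 2}"
    and "\<And>n. lam n \<in> {a..b}"
    and F_def: "F = (\<Inter>k\<in>{1..M}. VI (A k) C) \<inter> (\<Inter>k\<in>{1..N}. fixed_points_on C (S k))"
    and "interior F \<noteq> {}"
    and "x 0 \<in> C"
    and y: "\<And>n k. k \<in> {1..M} \<Longrightarrow>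
              y n k = gen_proj C (inv duality_map (duality_map (x n) - lam n *\<^sub>R A k (x n)))"
    and i: "\<And>n. is_arg_max (\<lambda>k. norm (y n k - x n)) (\<lambda>k. k \<in> {1..M}) (i n)"
    and ybar: "\<And>n. ybar n = y n (i n)"
    and z: "\<And>n k. k \<in> {1..N} \<Longrightarrow>
              z n k = inv duality_map
                (\<alpha>s n *\<^sub>R duality_map (x n) + (1 - \<alpha>s n) *\<^sub>R duality_map (S k (ybar n)))"
    and j: "\<And>n. is_arg_max (\<lambda>k. norm (z n k - x n)) (\<lambda>k. k \<in> {1..N}) (j n)"
    and zbar: "\<And>n. zbar n = z n (j n)"
    and x_step: "\<And>n. x (Suc n) = gen_proj C (zbar n)"
  shows "\<exists>u\<in>F. x \<longlonglongrightarrow> u \<and> (\<lambda>n. gen_proj F (x n)) \<longlonglongrightarrow> u"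
proof -
  interpret smooth_two_convex "TYPE('a)" by unfold_locales fact+

  \<comment> \<open>Constants and feasibility of the iterates\<close>
  have c: "0 < c" "\<And>x y :: 'a. norm (x - y) \<le> 2 / c\<^sup>2 * norm (J x - J y)"
    using two_convexity_c by (simp_all add: c_def)
  have a: "0 < a" and b: "b < \<alpha> * c\<^sup>2 / 2" and lam: "a \<le> lam n" "lam n \<le> b" for n
    using assms by auto
  have C: "C \<noteq> {}" "closed C" "convex C" by fact+
  have \<alpha>s: "\<alpha>s n \<in> {0..1}" for n by fact
  \<comment> \<open>A decrease coefficient valid for all \<open>n\<close>: the outer
    \<open>lam n\<close> is replaced by its lower bound \<open>a\<close>, the inner one by its upper
    bound \<open>b\<close>.\<close>
  define \<delta> where "\<delta> = 2 * a * (\<alpha> - 2 * b / c\<^sup>2)"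
  have gap: "0 < \<alpha> - 2 * b / c\<^sup>2" using b c by (simp add: field_simps)
  then have \<delta>: "0 < \<delta>" using a by (simp add: \<delta>_def)
  have \<delta>_le: "\<delta> \<le> 2 * lam n * (\<alpha> - 2 * lam n / c\<^sup>2)" for n
    unfolding \<delta>_def using a lam gap
    by (intro mult_mono diff_left_mono divide_right_mono) (auto intro: order_trans[OF less_imp_le[OF a]])
  have zeros: "VI (A k) C = {p \<in> C. A k p = 0}" if "k \<in> {1..M}" for k
    using V3[OF that] by (rule VI_eq_zeros)
  have F_zero: "q \<in> C" "A k q = 0" if "q \<in> F" "k \<in> {1..M}" for q k
    using that zeros by (auto simp: F_def)
  have F_fix: "q \<in> fixed_points_on C (S k)" if "q \<in> F" "k \<in> {1..N}" for q k
    using that by (auto simp: F_def)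
  have xC: "x n \<in> C" for n
    using \<open>x 0 \<in> C\<close> gen_proj_mem[OF C] by (cases n) (auto simp: x_step)
  have i_mem: "i n \<in> {1..M}" and i_max: "k \<in> {1..M} \<Longrightarrow> norm (y n k - x n) \<le> norm (ybar n - x n)" for n k
    using i[of n] by (auto simp: is_arg_max_linorder ybar)
  have j_mem: "j n \<in> {1..N}" and j_max: "k \<in> {1..N} \<Longrightarrow> norm (z n k - x n) \<le> norm (zbar n - x n)" for n k
    using j[of n] by (auto simp: is_arg_max_linorder zbar)

  \<comment> \<open>Decrease of the Lyapunov functional in one iteration\<close>
  define w where "w n k = inv J (J (x n) - lam n *\<^sub>R A k (x n))" for n k
  have Jw: "J (w n k) = J (x n) - lam n *\<^sub>R A k (x n)" for n k by (simp add: w_def)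
  have lam0: "0 \<le> lam n" for n using a lam[of n] by simp
  have y_w: "y n k = gen_proj C (w n k)" if "k \<in> {1..M}" for n k
    using y[OF that] by (simp add: w_def)
  have ybar_C: "ybar n \<in> C" for n using y_w[OF i_mem] gen_proj_mem[OF C] by (simp add: ybar)
  have y_le: "lyapunov q (y n k) \<le> lyapunov q (x n) - \<delta> * (norm (A k (x n)))\<^sup>2"
    if "q \<in> F" "k \<in> {1..M}" for q n k
  proof -
    have "lyapunov q (y n k) \<le> lyapunov q (w n k)"
      using gen_proj_three_point[OF C F_zero(1)[OF that], of "w n k"] lyapunov_nonneg[of "y n k" "w n k"]
      by (simp add: y_w[OF that(2)])
    also have "\<dots> \<le> lyapunov q (x n) - 2 * lam n * (\<alpha> - 2 * lam n / c\<^sup>2) * (norm (A k (x n)))\<^sup>2"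
      using lyapunov_forward_step[OF c(2) Jw lam0 refl V1[OF that(2)] xC F_zero[OF that]] .
    also have "\<dots> \<le> lyapunov q (x n) - \<delta> * (norm (A k (x n)))\<^sup>2"
      by (intro diff_left_mono mult_right_mono \<delta>_le) auto
    finally show ?thesis .
  qed
  have Jz: "J (z n k) = \<alpha>s n *\<^sub>R J (x n) + (1 - \<alpha>s n) *\<^sub>R J (S k (ybar n))" if "k \<in> {1..N}" for n k
    using z[OF that] by simp
  define e where "e n = norm (A (i n) (x n))" for n
  \<comment> \<open>The projection defect \<open>lyapunov (x (Suc n)) (zbar n)\<close> is kept on
    the left, since its vanishing later shows that \<open>zbar\<close> has the same limit as
    \<open>x\<close>.\<close>
  have x_le: "lyapunov q (x (Suc n)) + lyapunov (x (Suc n)) (zbar n)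
      \<le> lyapunov q (x n) - (1 - \<alpha>s n) * (\<delta> * (e n)\<^sup>2)" if q: "q \<in> F" for q n
  proof -
    have "lyapunov q (S (j n) (ybar n)) \<le> lyapunov q (ybar n)"
      using S_quasi[OF j_mem] F_fix[OF q j_mem] ybar_C unfolding quasi_phi_nonexpansive_on_def by blast
    also have "\<dots> \<le> lyapunov q (x n) - \<delta> * (e n)\<^sup>2"
      using y_le[OF q i_mem] by (simp add: ybar e_def)
    finally have S_le: "lyapunov q (S (j n) (ybar n)) \<le> lyapunov q (x n) - \<delta> * (e n)\<^sup>2" .
    have "lyapunov q (x (Suc n)) + lyapunov (x (Suc n)) (zbar n) \<le> lyapunov q (zbar n)"
      unfolding x_step using F_zero(1)[OF q i_mem] by (rule gen_proj_three_point[OF C])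
    also have "\<dots> \<le> \<alpha>s n * lyapunov q (x n) + (1 - \<alpha>s n) * lyapunov q (S (j n) (ybar n))"
      unfolding zbar by (rule lyapunov_dual_convex[OF \<alpha>s Jz[OF j_mem]])
    also have "\<dots> \<le> \<alpha>s n * lyapunov q (x n) + (1 - \<alpha>s n) * (lyapunov q (x n) - \<delta> * (e n)\<^sup>2)"
      using \<alpha>s[of n] S_le by (intro add_left_mono mult_left_mono) auto
    also have "\<dots> = lyapunov q (x n) - (1 - \<alpha>s n) * (\<delta> * (e n)\<^sup>2)" by (simp add: algebra_simps)
    finally show ?thesis .
  qed
  have e_nonneg: "0 \<le> (1 - \<alpha>s n) * (\<delta> * (e n)\<^sup>2)" for n using \<alpha>s[of n] \<delta> by simp

  \<comment> \<open>Strong convergence of the iterates\<close>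
  have "convergent x"
  proof (rule fejer_monotone_convergent[OF \<open>interior F \<noteq> {}\<close>])
    fix q n assume "q \<in> F"
    from x_le[OF this, of n] show "lyapunov q (x (Suc n)) \<le> lyapunov q (x n)"
      using e_nonneg[of n] lyapunov_nonneg[of "x (Suc n)" "zbar n"] by linarith
  qed
  then obtain u where u: "x \<longlonglongrightarrow> u" by (auto simp: convergent_def)
  have uC: "u \<in> C" using closed_sequentially[OF C(2) _ u] xC by blast
  have to_u: "f \<longlonglongrightarrow> u" if "(\<lambda>n. f n - x n) \<longlonglongrightarrow> 0" for f
    using tendsto_add[OF that u] by simp

  \<comment> \<open>Limits of the intermediate sequences\<close>
  obtain q where q: "q \<in> F" using \<open>interior F \<noteq> {}\<close> interior_subset by blast
  define d where "d n = lyapunov q (x n) - lyapunov q (x (Suc n))" for n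
  have "d \<longlonglongrightarrow> lyapunov q u - lyapunov q u"
    unfolding d_def by (intro tendsto_intros u LIMSEQ_Suc)
  then have d: "d \<longlonglongrightarrow> 0" by simp
  have d_ge: "lyapunov (x (Suc n)) (zbar n) + (1 - \<alpha>s n) * (\<delta> * (e n)\<^sup>2) \<le> d n" for n
    using x_le[OF q, of n] by (simp add: d_def)

  have "(\<lambda>n. lyapunov (x (Suc n)) (zbar n)) \<longlonglongrightarrow> 0"
  proof (rule null_comparison[OF d])
    fix n show "norm (lyapunov (x (Suc n)) (zbar n)) \<le> d n"
      using d_ge[of n] e_nonneg[of n] lyapunov_nonneg[of "x (Suc n)" "zbar n"] by simp
  qed
  then have "(\<lambda>n. x (Suc n) - zbar n) \<longlonglongrightarrow> 0" by (rule lyapunov_tendsto_zeroD)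
  from tendsto_diff[OF LIMSEQ_Suc[OF u] this] have "zbar \<longlonglongrightarrow> u" by simp
  then have zx: "(\<lambda>n. norm (zbar n - x n)) \<longlonglongrightarrow> 0"
    using tendsto_diff[OF _ u] tendsto_norm_zero by fastforce
  \<comment> \<open>The maximal choice of \<open>j n\<close> makes \<open>zbar n\<close> the
    farthest candidate from \<open>x n\<close>, so it controls every index \<open>k\<close>.\<close>
  have z_u: "(\<lambda>n. z n k) \<longlonglongrightarrow> u" if "k \<in> {1..N}" for k
    by (rule to_u, rule null_comparison[OF zx]) (rule j_max[OF that])

  have "(\<lambda>n. (e n)\<^sup>2) \<longlonglongrightarrow> 0"
  proof (rule Lim_null_comparison)
    show "(\<lambda>n. 2 / \<delta> * d n) \<longlonglongrightarrow> 0" by (rule tendsto_mult_right_zero[OF d])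
    \<comment> \<open>The weight \<open>1 - \<alpha>s n\<close> must stay away from 0; the bound
      \<open>1/2\<close> explains the factor 2 in \<open>2 / \<delta>\<close>.\<close>
    have "\<forall>\<^sub>F n in sequentially. \<alpha>s n < 1/2"
      using \<open>\<alpha>s \<longlonglongrightarrow> 0\<close> by (rule order_tendstoD) simp
    then show "\<forall>\<^sub>F n in sequentially. norm ((e n)\<^sup>2) \<le> 2 / \<delta> * d n"
    proof eventually_elim
      case (elim n)
      have "1/2 * (\<delta> * (e n)\<^sup>2) \<le> (1 - \<alpha>s n) * (\<delta> * (e n)\<^sup>2)"
        using elim \<delta> by (intro mult_right_mono) auto
      also have "\<dots> \<le> d n" using d_ge[of n] lyapunov_nonneg[of "x (Suc n)" "zbar n"] by linarith
      finally show ?case using \<delta> by (simp add: field_simps)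
    qed
  qed
  then have e: "(\<lambda>n. (e n)\<^sup>2) \<longlonglongrightarrow> 0" "e \<longlonglongrightarrow> 0"
    using tendsto_real_sqrt[of "\<lambda>n. (e n)\<^sup>2" 0] by (simp_all add: e_def[abs_def])
  have wx: "(\<lambda>n. w n (i n) - x n) \<longlonglongrightarrow> 0"
  proof (rule null_comparison)
    show "(\<lambda>n. 2 / c\<^sup>2 * (b * e n)) \<longlonglongrightarrow> 0" by (intro tendsto_mult_right_zero e)
    fix n
    have "norm (w n (i n) - x n) \<le> 2 / c\<^sup>2 * (lam n * e n)"
      unfolding e_def by (rule forward_step_displacement[OF c(2) Jw lam0])
    also have "\<dots> \<le> 2 / c\<^sup>2 * (b * e n)"
      using lam by (intro mult_left_mono mult_right_mono) (auto simp: e_def)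
    finally show "norm (w n (i n) - x n) \<le> 2 / c\<^sup>2 * (b * e n)" .
  qed
  have "(\<lambda>n. lyapunov (ybar n) (w n (i n))) \<longlonglongrightarrow> 0"
  proof (rule null_comparison)
    show "(\<lambda>n. 4 / c\<^sup>2 * b\<^sup>2 * (e n)\<^sup>2) \<longlonglongrightarrow> 0" by (intro tendsto_mult_right_zero e)
    fix n
    \<comment> \<open>\<open>x n\<close> lies in \<open>C\<close> and so competes with the
      projection \<open>ybar n\<close> of \<open>w n (i n)\<close>.\<close>
    have "lyapunov (ybar n) (w n (i n)) \<le> lyapunov (x n) (w n (i n))"
      unfolding ybar y_w[OF i_mem] by (rule gen_proj_le[OF C xC])
    also have "\<dots> \<le> 4 / c\<^sup>2 * (lam n)\<^sup>2 * (e n)\<^sup>2"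
      unfolding e_def by (rule lyapunov_forward_step_self[OF c(2) Jw lam0])
    also have "\<dots> \<le> 4 / c\<^sup>2 * b\<^sup>2 * (e n)\<^sup>2"
      using lam lam0 by (intro mult_left_mono mult_right_mono power_mono) auto
    finally show "norm (lyapunov (ybar n) (w n (i n))) \<le> 4 / c\<^sup>2 * b\<^sup>2 * (e n)\<^sup>2"
      using lyapunov_nonneg by simp
  qed
  then have "(\<lambda>n. ybar n - w n (i n)) \<longlonglongrightarrow> 0" by (rule lyapunov_tendsto_zeroD)
  from tendsto_add[OF this wx] have yx: "(\<lambda>n. ybar n - x n) \<longlonglongrightarrow> 0" by simp
  then have ybar_u: "ybar \<longlonglongrightarrow> u" by (rule to_u)
  have y_u: "(\<lambda>n. y n k) \<longlonglongrightarrow> u" if "k \<in> {1..M}" for k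
    by (rule to_u, rule null_comparison[OF tendsto_norm_zero[OF yx]]) (rule i_max[OF that])

  \<comment> \<open>The limit solves the variational inequalities\<close>
  have "A k u = 0" if k: "k \<in> {1..M}" for k
  proof -
    \<comment> \<open>The sequence \<open>e\<close> only sees the selected index \<open>i n\<close>.
      For arbitrary \<open>k\<close> the loss is recovered from \<open>y_le\<close>, as
      \<open>x n\<close> and \<open>y n k\<close> have the same limit.\<close>
    have "(\<lambda>n. (lyapunov q (x n) - lyapunov q (y n k)) / \<delta>) \<longlonglongrightarrow> (lyapunov q u - lyapunov q u) / \<delta>"
      using \<delta> by (intro tendsto_intros u y_u k) auto
    then have lim: "(\<lambda>n. (lyapunov q (x n) - lyapunov q (y n k)) / \<delta>) \<longlonglongrightarrow> 0" by simp
    have "(\<lambda>n. (norm (A k (x n)))\<^sup>2) \<longlonglongrightarrow> 0"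
      by (rule null_comparison[OF lim]) (use y_le[OF q k] \<delta> in \<open>simp add: field_simps\<close>)
    moreover have "(\<lambda>n. (norm (A k (x n)))\<^sup>2) \<longlonglongrightarrow> (norm (A k u))\<^sup>2"
      by (intro tendsto_intros inverse_strongly_monotone_tendsto[OF V1[OF k] \<open>0 < \<alpha>\<close>] xC uC u)
    ultimately have "(norm (A k u))\<^sup>2 = 0" using LIMSEQ_unique by blast
    then show ?thesis by simp
  qed
  then have u_VI: "u \<in> VI (A k) C" if "k \<in> {1..M}" for k using zeros[OF that] uC that by simp

  \<comment> \<open>The limit is a common fixed point\<close>
  have u_fix: "u \<in> fixed_points_on C (S k)" if k: "k \<in> {1..N}" for k
  proof -
    have "(\<lambda>n. J (S k (ybar n))) \<longlonglongrightarrow> J u"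
    proof (rule Lim_transform_eventually)
      \<comment> \<open>The convex combination defining \<open>z n k\<close> is solved for
        \<open>J (S k (ybar n))\<close>, which is possible once
        \<open>\<alpha>s n < 1\<close>.\<close>
      have "(\<lambda>n. inverse (1 - \<alpha>s n) *\<^sub>R (J (z n k) - \<alpha>s n *\<^sub>R J (x n)))
          \<longlonglongrightarrow> inverse (1 - 0) *\<^sub>R (J u - 0 *\<^sub>R J u)"
        by (intro tendsto_intros z_u[OF k] u \<open>\<alpha>s \<longlonglongrightarrow> 0\<close>) simp
      then show "(\<lambda>n. inverse (1 - \<alpha>s n) *\<^sub>R (J (z n k) - \<alpha>s n *\<^sub>R J (x n))) \<longlonglongrightarrow> J u" by simp
      have "\<forall>\<^sub>F n in sequentially. \<alpha>s n < 1"
        using \<open>\<alpha>s \<longlonglongrightarrow> 0\<close> by (rule order_tendstoD) simp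
      then show "\<forall>\<^sub>F n in sequentially.
          inverse (1 - \<alpha>s n) *\<^sub>R (J (z n k) - \<alpha>s n *\<^sub>R J (x n)) = J (S k (ybar n))"
        by eventually_elim (simp add: Jz[OF k])
    qed
    then have "(\<lambda>n. S k (ybar n)) \<longlonglongrightarrow> u" by (rule tendsto_of_tendsto_J)
    then have "S k u = u"
      using S_closed[OF k] ybar_C ybar_u unfolding closed_mapping_on_def by blast
    then show ?thesis using uC by (simp add: fixed_points_on_def)
  qed
  have uF: "u \<in> F" using u_VI u_fix by (simp add: F_def)

  \<comment> \<open>Projections of the iterates onto \<open>F\<close>\<close>
  have "F \<noteq> {}" using uF by blast
  moreover have "closed F"
    unfolding F_def
    using zeros inverse_strongly_monotone_zeros_closed[OF V1 \<open>0 < \<alpha>\<close> C(2)]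
      closed_mapping_fixed_points_closed[OF C(2) S_closed]
    by (intro closed_Int closed_INT) auto
  moreover have "convex F"
    unfolding F_def
    using zeros inverse_strongly_monotone_zeros_convex[OF V1 \<open>0 < \<alpha>\<close> C(3)]
      quasi_phi_nonexpansive_fixed_points_convex[OF C(3) S_quasi]
    by (intro convex_Int convex_INT) auto
  ultimately have F: "F \<noteq> {}" "closed F" "convex F" .
  have "(\<lambda>n. lyapunov u (x n)) \<longlonglongrightarrow> lyapunov u u" by (intro tendsto_intros u)
  then have "(\<lambda>n. lyapunov u (x n)) \<longlonglongrightarrow> 0" by simp
  \<comment> \<open>The limit \<open>u\<close> lies in \<open>F\<close> and competes in the
    minimization that defines the projection.\<close>
  then have "(\<lambda>n. lyapunov (gen_proj F (x n)) (x n)) \<longlonglongrightarrow> 0"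
    by (rule null_comparison) (use gen_proj_le[OF F uF] lyapunov_nonneg in simp)
  then have "(\<lambda>n. gen_proj F (x n)) \<longlonglongrightarrow> u" by (intro to_u lyapunov_tendsto_zeroD)
  then show ?thesis using uF u by blast
qed

end
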